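(* Assume that $J$ is of class $C^1$ on $\mathbb{R}^N$, that $\mathcal{X}$ and $u_0$ are of class $C^1$ on $\overline{\Omega}$, and that $g$ is of class $C^2$. Let $h_0$ be one of the two functions $$h_0(x)\equiv1\ \text{ in }\mathbb{R}^N\ \text{(Dirichlet problem)},\qquad h_0(x)=\int_{\mathbb{R}^N}J(x-y)\big(1-\chi_\Omega(y)+\mathcal{X}(y)\big)\,dy\ \text{ (Neumann problem)},$$ where $\chi_\Omega$ is the characteristic function of $\Omega$. For each $\delta>0$ let $u^\delta$ be the solution of $$u^\delta_t(x,t)=\mathcal{X}(x)\int_{\mathbb{R}^N}J(x-y)\,u^\delta(y,t)\,dy-h_0(x)\,u^\delta(x,t)+\mathcal{X}(x)\,g\big(m_{\mathcal{X}}^{\delta}(x,u^\delta(\cdot,t))\big),\qquad x\in\Omega,\ t\in\mathbb{R},$$ $$u^\delta(x,t)\equiv0\ \text{ for }x\in\mathbb{R}^N\setminus\Omega,\ t\in\mathbb{R},\qquad u^\delta(x,0)=\mathcal{X}(x)\,u_0(x).$$ Then there exists a function $\bar u=\bar u(x,t)$, $x\in\mathbb{R}^N$, $t\in\mathbb{R}$, with $\bar u(x,t)\equiv0$ for $x\in\mathbb{R}^N\setminus\Omega$ and $\bar u\in C^1([a,b];L^2(\mathbb{R}^N))$ for every closed bounded interval $[a,b]\subset\mathbb{R}$, such that $$u^\delta\rightharpoonup\bar u\quad\text{weakly}^*\text{ in }L^\infty([a,b];L^2(\Omega))\ \text{ as }\delta\to0$$ for every such $[a,b]$. Furthermore, $u=\bar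 u$ satisfies the following nonlocal equation in $\Omega$: $$u_t(x,t)=\mathcal{X}(x)\int_{\mathbb{R}^N}J(x-y)\,u(y,t)\,dy-h_0(x)\,u(x,t)+\mathcal{X}(x)\,g\!\left(\frac{1}{\mathcal{X}(x)}\,u(x,t)\right),$$ with $u(x,t)\equiv0$ for $x\in\mathbb{R}^N\setminus\Omega$ and $u(x,0)=\mathcal{X}(x)\,u_0(x)$.
   Context: $\Omega\subset\mathbb{R}^N$ is a fixed bounded open domain and $\Omega^\varepsilon\subset\Omega$ ($\varepsilon>0$) is a family of open sets with characteristic functions $\chi_\varepsilon$. The function $\mathcal{X}\in L^\infty(\mathbb{R}^N)$ satisfies $\mathcal{X}\equiv0$ in $\mathbb{R}^N\setminus\Omega$ and is the weak$^*$ limit of $\chi_\varepsilon$: $\int_\Omega\chi_\varepsilon\varphi\,dx\to\int_\Omega\mathcal{X}\varphi\,dx$ as $\varepsilon\to0$ for all $\varphi\in L^1(\Omega)$; moreover there is a constant $c>0$ with $\mathcal{X}(x)\ge c$ for all $x\in\Omega$ (and $\mathcal{X}\le1$). "Of class $C^1$ on $\overline\Omega$" means that the function coincides on $\Omega$ with a $C^1$ function on $\mathbb{R}^N$. The kernel $J\in C(\mathbb{R}^N,\mathbb{R})$ is non-negative with $J(0)>0$, $J(-x)=J(x)$ for every $x$, and $\int_{\mathbb{R}^N}J(x)\,dx=1$. The function $g:\mathbb{R}\to\mathbb{R}$ is globally Lipschitz. With $B_\delta(x)$ the ball of radius $\delta$ centered at $x$, $$m_{\mathcal{X}}^{\delta}(x,u)=\frac{1}{\int_{B_\delta(x)}\mathcal{X}(y)\,dy}\int_{B_\delta(x)}u(y)\,dy,\quad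 x\in\Omega.$$ The solution $u^\delta$ is the unique global one, with $u^\delta\in C^1([a,b];L^2(\Omega))$ for every bounded interval $[a,b]\subset\mathbb{R}$, and the equations are understood in $L^2(\Omega)$ for each $t$. *)

theory Defs
  imports "HOL-Analysis.Analysis"
begin

definition C1 :: "('a::euclidean_space \<Rightarrow> real) \<Rightarrow> bool" where
  "C1 f \<longleftrightarrow> (\<exists>f' :: 'a \<Rightarrow> 'a \<Rightarrow>\<^sub>L real.
      (\<forall>x. (f has_derivative blinfun_apply (f' x)) (at x)) \<and> continuous_on UNIV f')"

text \<open>Being of class $C^1$ on the closure of \<open>S\<close> only constrains the values on \<open>S\<close>.\<close>

definition C1_closure :: "'a::euclidean_space set \<Rightarrow> ('a \<Rightarrow> real) \<Rightarrow> bool" where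
  "C1_closure S f \<longleftrightarrow> (\<exists>F. C1 F \<and> (\<forall>x\<in>S. f x = F x))"

definition C2 :: "(real \<Rightarrow> real) \<Rightarrow> bool" where
  "C2 g \<longleftrightarrow> (\<exists>g' g''. (\<forall>s. (g has_real_derivative g' s) (at s)) \<and>
      (\<forall>s. (g' has_real_derivative g'' s) (at s)) \<and> continuous_on UNIV g'')"

text \<open>Elements of $L^2(S)$ are represented by functions on the whole space; only their
  restriction to \<open>S\<close>, up to null sets, matters.\<close>

definition L2_space :: "'a::euclidean_space set \<Rightarrow> ('a \<Rightarrow> real) set" where
  "L2_space S = {f. f \<in> borel_measurable (lebesgue_on S) \<and>
                    integrable (lebesgue_on S) (\<lambda>x. (f x)\<^sup>2)}"

definition L2_norm :: "'a::euclidean_space set \<Rightarrow> ('a \<Rightarrow> real) \<Rightarrow> real" where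
  "L2_norm S f = sqrt (LINT x|lebesgue_on S. (f x)\<^sup>2)"

text \<open>Time-dependent functions are written \<open>u t x\<close>, so that \<open>u\<close> is a curve \<open>t \<mapsto> u t\<close> in
  $L^2(S)$. Membership in \<open>L2_space\<close> is required explicitly because \<open>L2_norm\<close> is \<open>0\<close> on
  functions that are not square integrable.\<close>

definition L2_continuous_on ::
    "'a::euclidean_space set \<Rightarrow> real set \<Rightarrow> (real \<Rightarrow> 'a \<Rightarrow> real) \<Rightarrow> bool" where
  "L2_continuous_on S I u \<longleftrightarrow> (\<forall>t\<in>I. u t \<in> L2_space S) \<and>
     (\<forall>t\<in>I. ((\<lambda>s. L2_norm S (\<lambda>x. u s x - u t x)) \<longlongrightarrow> 0) (at t within I))"

definition L2_has_derivative ::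
    "'a::euclidean_space set \<Rightarrow> real set \<Rightarrow> (real \<Rightarrow> 'a \<Rightarrow> real) \<Rightarrow> ('a \<Rightarrow> real) \<Rightarrow> real \<Rightarrow> bool" where
  "L2_has_derivative S I u v t \<longleftrightarrow> (\<forall>s\<in>I. u s \<in> L2_space S) \<and> v \<in> L2_space S \<and>
     ((\<lambda>s. L2_norm S (\<lambda>x. (u s x - u t x) / (s - t) - v x)) \<longlongrightarrow> 0) (at t within I)"

definition C1_L2 ::
    "'a::euclidean_space set \<Rightarrow> real set \<Rightarrow> (real \<Rightarrow> 'a \<Rightarrow> real) \<Rightarrow> bool" where
  "C1_L2 S I u \<longleftrightarrow> (\<exists>v. L2_continuous_on S I v \<and> (\<forall>t\<in>I. L2_has_derivative S I u (v t) t))"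

definition L2_simple_function ::
    "'a::euclidean_space set \<Rightarrow> real set \<Rightarrow> (real \<Rightarrow> 'a \<Rightarrow> real) \<Rightarrow> bool" where
  "L2_simple_function S I s \<longleftrightarrow> (\<exists>(n::nat) A f.
     (\<forall>i<n. A i \<in> sets (lebesgue_on I) \<and> f i \<in> L2_space S) \<and>
     s = (\<lambda>t x. \<Sum>i<n. indicator (A i) t * f i x))"

text \<open>Strong (Bochner) measurability of an $L^2(S)$-valued function on \<open>I\<close>.\<close>

definition L2_strongly_measurable ::
    "'a::euclidean_space set \<Rightarrow> real set \<Rightarrow> (real \<Rightarrow> 'a \<Rightarrow> real) \<Rightarrow> bool" where
  "L2_strongly_measurable S I w \<longleftrightarrow> (AE t in lebesgue_on I. w t \<in> L2_space S) \<and>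
     (\<exists>s. (\<forall>k. L2_simple_function S I (s k)) \<and>
        (AE t in lebesgue_on I. (\<lambda>k::nat. L2_norm S (\<lambda>x. s k t x - w t x)) \<longlonglongrightarrow> 0))"

definition L1_L2 ::
    "'a::euclidean_space set \<Rightarrow> real set \<Rightarrow> (real \<Rightarrow> 'a \<Rightarrow> real) \<Rightarrow> bool" where
  "L1_L2 S I w \<longleftrightarrow> L2_strongly_measurable S I w \<and>
     integrable (lebesgue_on I) (\<lambda>t. L2_norm S (w t))"

definition Linf_L2 ::
    "'a::euclidean_space set \<Rightarrow> real set \<Rightarrow> (real \<Rightarrow> 'a \<Rightarrow> real) \<Rightarrow> bool" where
  "Linf_L2 S I w \<longleftrightarrow> L2_strongly_measurable S I w \<and>
     (\<exists>C. AE t in lebesgue_on I. L2_norm S (w t) \<le> C)"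

text \<open>Weak* convergence in $L^\infty(I;L^2(S))$, regarded as the dual of $L^1(I;L^2(S))$.\<close>

definition Linf_L2_weakstar_tendsto ::
    "'a::euclidean_space set \<Rightarrow> real set \<Rightarrow> (real \<Rightarrow> real \<Rightarrow> 'a \<Rightarrow> real) \<Rightarrow>
     (real \<Rightarrow> 'a \<Rightarrow> real) \<Rightarrow> real filter \<Rightarrow> bool" where
  "Linf_L2_weakstar_tendsto S I w w0 F \<longleftrightarrow>
     (\<forall>\<^sub>F d in F. Linf_L2 S I (w d)) \<and> Linf_L2 S I w0 \<and>
     (\<forall>\<phi>. L1_L2 S I \<phi> \<longrightarrow>
        ((\<lambda>d. LINT t|lebesgue_on I. (LINT x|lebesgue_on S. w d t x * \<phi> t x)) \<longlongrightarrow>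
         (LINT t|lebesgue_on I. (LINT x|lebesgue_on S. w0 t x * \<phi> t x))) F)"

definition local_mean ::
    "('a::euclidean_space \<Rightarrow> real) \<Rightarrow> real \<Rightarrow> 'a \<Rightarrow> ('a \<Rightarrow> real) \<Rightarrow> real" where
  "local_mean X \<delta> x w =
     1 / (LINT y:ball x \<delta>|lebesgue. X y) * (LINT y:ball x \<delta>|lebesgue. w y)"

definition neumann_coeff ::
    "'a::euclidean_space set \<Rightarrow> ('a \<Rightarrow> real) \<Rightarrow> ('a \<Rightarrow> real) \<Rightarrow> 'a \<Rightarrow> real" where
  "neumann_coeff \<Omega> J X x = (LINT y|lebesgue. J (x - y) * (1 - indicator \<Omega> y + X y))"

text \<open>Global solutions of
    \[ u_t(x,t) = X(x) \int J(x-y) u(y,t)\,dy - h_0(x) u(x,t) + X(x)\, g(M(x, u(\cdot,t))),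
       \qquad x \in \Omega,\ t \in \mathbb{R}, \]
  vanishing outside \<open>\<Omega>\<close>, with initial value \<open>X u\<^sub>0\<close>. The operator \<open>M\<close> is a parameter, so that
  the problem with the local mean and its limit are instances. The derivative, the equation and
  the initial condition are those of $L^2(\Omega)$.\<close>

definition nonlocal_solution ::
    "'a::euclidean_space set \<Rightarrow> ('a \<Rightarrow> real) \<Rightarrow> ('a \<Rightarrow> real) \<Rightarrow> ('a \<Rightarrow> real) \<Rightarrow> (real \<Rightarrow> real) \<Rightarrow>
     ('a \<Rightarrow> ('a \<Rightarrow> real) \<Rightarrow> real) \<Rightarrow> ('a \<Rightarrow> real) \<Rightarrow> (real \<Rightarrow> 'a \<Rightarrow> real) \<Rightarrow> bool" where
  "nonlocal_solution \<Omega> J X h\<^sub>0 g M u\<^sub>0 u \<longleftrightarrow>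
     (\<forall>a b. a < b \<longrightarrow> C1_L2 \<Omega> {a..b} u) \<and>
     (\<forall>t. L2_has_derivative \<Omega> UNIV u
        (\<lambda>x. X x * (LINT y|lebesgue. J (x - y) * u t y) - h\<^sub>0 x * u t x + X x * g (M x (u t))) t) \<and>
     (\<forall>t x. x \<notin> \<Omega> \<longrightarrow> u t x = 0) \<and>
     (AE x in lebesgue_on \<Omega>. u 0 x = X x * u\<^sub>0 x)"

end

theory Submission
  imports Defs
begin

text \<open>
  No compactness of the family of solutions is needed: the solutions converge strongly, namely in $L^2(\Omega)$ uniformly
  for \<open>t\<close> in bounded intervals, and this implies the weak* convergence.

  The limit \<open>ubar\<close> is constructed first, as the solution of the limit equation. On \<open>\<Omega>\<close> the data
  \<open>X\<close>, \<open>u\<^sub>0\<close>, \<open>h\<^sub>0\<close> and, on differences of points of \<open>\<Omega>\<close>, the kernel \<open>J\<close> coincide with bounded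
  continuous functions, so the limit equation is an ordinary differential equation with a globally
  Lipschitz right-hand side in the Banach space of bounded continuous functions. It has a global
  solution \<open>v\<close> (\<open>Lipschitz_ode_global_solution\<close>), and \<open>ubar\<close> is \<open>v\<close> multiplied by the
  indicator of \<open>\<Omega>\<close>.

  Let \<open>w = u \<delta> - ubar\<close>. The difference of the nonlinear terms is at most \<open>L\<close> times
  \<open>\<bar>local_mean w\<bar> + \<bar>local_mean ubar - ubar / X\<bar>\<close>.
  The first summand is bounded by \<open>k * \<parallel>w\<parallel>\<close> in $L^2(\Omega)$ with \<open>k\<close> independent
  of \<open>\<delta>\<close>: this is \<open>local_mean_L2\<close>, which rests on the covering argument in \<open>covering_bound\<close> and
  holds for every bounded open \<open>\<Omega>\<close>, whatever its boundary. The second summand, the residual, tends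
  to \<open>0\<close> in $L^2(\Omega)$ uniformly for \<open>t\<close> in bounded intervals (\<open>residual_uniform\<close>): for fixed \<open>t\<close> by
  continuity and dominated convergence, then uniformly because \<open>v\<close> is continuous in time and the
  residual operators are bounded uniformly in \<open>\<delta>\<close>. As the remaining terms are linear and
  bounded, $\varphi(t)=\|w(t)\|^2$ satisfies $|\varphi'|\le K\varphi+\eta$ with $\eta\to0$ as
  \<open>\<delta>\<close> tends to \<open>0\<close>, and \<open>\<phi> 0 = 0\<close>; Gronwall's inequality concludes.
\<close>

section \<open>Square integrable functions\<close>

lemma L2_spaceD:
  assumes "f \<in> L2_space S"
  shows "f \<in> borel_measurable (lebesgue_on S)" "integrable (lebesgue_on S) (\<lambda>x. (f x)\<^sup>2)"
  using assms by (auto simp: L2_space_def)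

lemma L2_integrable_mult:
  assumes "f \<in> L2_space S" "g \<in> L2_space S"
  shows "integrable (lebesgue_on S) (\<lambda>x. f x * g x)"
proof (rule Bochner_Integration.integrable_bound)
  show "integrable (lebesgue_on S) (\<lambda>x. (f x)\<^sup>2 + (g x)\<^sup>2)"
    using assms by (auto dest: L2_spaceD)
  show "(\<lambda>x. f x * g x) \<in> borel_measurable (lebesgue_on S)"
    by (intro borel_measurable_times L2_spaceD assms)
  have "\<bar>a * b\<bar> \<le> a\<^sup>2 + b\<^sup>2" for a b :: real
  proof -
    have "2 * (\<bar>a\<bar> * \<bar>b\<bar>) \<le> a\<^sup>2 + b\<^sup>2"
      using sum_squares_bound[of "\<bar>a\<bar>" "\<bar>b\<bar>"] by (simp only: power2_abs mult.assoc)
    moreover have "0 \<le> \<bar>a\<bar> * \<bar>b\<bar>" by simp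
    ultimately show ?thesis unfolding abs_mult by linarith
  qed
  then show "AE x in lebesgue_on S. norm (f x * g x) \<le> norm ((f x)\<^sup>2 + (g x)\<^sup>2)"
    by simp
qed

lemma L2_space_cmult: "f \<in> L2_space S \<Longrightarrow> (\<lambda>x. a * f x) \<in> L2_space S"
  by (auto simp: L2_space_def power_mult_distrib)

lemma L2_space_divide: "f \<in> L2_space S \<Longrightarrow> (\<lambda>x. f x / a) \<in> L2_space S"
  by (auto simp: L2_space_def power_divide)

lemma L2_space_add:
  assumes "f \<in> L2_space S" "g \<in> L2_space S"
  shows "(\<lambda>x. f x + g x) \<in> L2_space S"
  using assms L2_integrable_mult[OF assms]
  by (auto simp: L2_space_def power2_sum mult.assoc)

lemma L2_space_diff:
  assumes "f \<in> L2_space S" "g \<in> L2_space S"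
  shows "(\<lambda>x. f x - g x) \<in> L2_space S"
  using L2_space_add[OF assms(1) L2_space_cmult[OF assms(2), of "-1"]] by simp

lemma L2_space_zero [simp]: "(\<lambda>x. 0) \<in> L2_space S"
  by (auto simp: L2_space_def)

lemma L2_space_sum:
  "(\<And>i. i \<in> A \<Longrightarrow> f i \<in> L2_space S) \<Longrightarrow> (\<lambda>x. \<Sum>i\<in>A. f i x) \<in> L2_space S"
  by (induction A rule: infinite_finite_induct) (auto intro: L2_space_add)

lemma L2_norm_nonneg [simp]: "0 \<le> L2_norm S f"
  by (simp add: L2_norm_def)

lemma L2_norm_power2: "(L2_norm S f)\<^sup>2 = (LINT x|lebesgue_on S. (f x)\<^sup>2)"
  by (simp add: L2_norm_def)

lemma L2_norm_cong: "(\<And>x. x \<in> S \<Longrightarrow> f x = g x) \<Longrightarrow> L2_norm S f = L2_norm S g"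
  unfolding L2_norm_def by (intro arg_cong[where f=sqrt] Bochner_Integration.integral_cong) auto

lemma L2_space_cong:
  assumes "\<And>x. x \<in> S \<Longrightarrow> f x = g x"
  shows "f \<in> L2_space S \<longleftrightarrow> g \<in> L2_space S"
proof -
  have "f \<in> borel_measurable (lebesgue_on S) \<longleftrightarrow> g \<in> borel_measurable (lebesgue_on S)"
    by (rule measurable_cong) (use assms in auto)
  moreover have "integrable (lebesgue_on S) (\<lambda>x. (f x)\<^sup>2) \<longleftrightarrow>
      integrable (lebesgue_on S) (\<lambda>x. (g x)\<^sup>2)"
    by (rule Bochner_Integration.integrable_cong) (use assms in auto)
  ultimately show ?thesis by (simp add: L2_space_def)
qed

lemma L2_norm_cmult: "L2_norm S (\<lambda>x. a * f x) = \<bar>a\<bar> * L2_norm S f"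
  by (simp add: L2_norm_def power_mult_distrib real_sqrt_mult)

lemma L2_norm_minus_commute: "L2_norm S (\<lambda>x. f x - g x) = L2_norm S (\<lambda>x. g x - f x)"
  by (simp add: L2_norm_def power2_commute)

lemma nonneg_quadratic_imp_discriminant:
  fixes A B C :: real
  assumes quad: "\<And>t. 0 \<le> A + 2 * t * B + t\<^sup>2 * C" and C: "0 \<le> C"
  shows "B\<^sup>2 \<le> A * C"
proof (cases "C = 0")
  case True
  have "B = 0"
  proof (rule ccontr)
    assume B: "B \<noteq> 0"
    define t where "t = - (A + 1) / (2 * B)"
    have "2 * t * B = - (A + 1)" using B by (simp add: t_def)
    then show False using quad[of t] True by simp
  qed
  then show ?thesis using True by simp
next
  case False
  define t where "t = - B / C"
  have tC: "t * C = - B" using False by (simp add: t_def)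
  have "A + 2 * t * B + t\<^sup>2 * C = A + 2 * t * B + t * (t * C)"
    by (simp add: power2_eq_square)
  also have "\<dots> = A + t * B" by (simp add: tC)
  finally have "0 \<le> A + t * B" using quad[of t] by linarith
  then have "0 \<le> (A + t * B) * C" using C by (rule mult_nonneg_nonneg)
  also have "(A + t * B) * C = A * C + (t * C) * B" by (simp add: algebra_simps)
  also have "\<dots> = A * C - B\<^sup>2" by (simp add: tC power2_eq_square)
  finally show ?thesis by simp
qed

lemma L2_Cauchy_Schwarz:
  assumes f: "f \<in> L2_space S" and g: "g \<in> L2_space S"
  shows "\<bar>LINT x|lebesgue_on S. f x * g x\<bar> \<le> L2_norm S f * L2_norm S g"
proof -
  let ?A = "LINT x|lebesgue_on S. (f x)\<^sup>2" and ?C = "LINT x|lebesgue_on S. (g x)\<^sup>2"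
  let ?B = "LINT x|lebesgue_on S. f x * g x"
  have quad: "0 \<le> ?A + 2 * t * ?B + t\<^sup>2 * ?C" for t
  proof -
    have "0 \<le> (LINT x|lebesgue_on S. (f x + t * g x)\<^sup>2)" by simp
    also have "\<dots> = (LINT x|lebesgue_on S. (f x)\<^sup>2 + 2 * t * (f x * g x) + t\<^sup>2 * (g x)\<^sup>2)"
      by (intro Bochner_Integration.integral_cong) (auto simp: power2_eq_square algebra_simps)
    also have "\<dots> = ?A + 2 * t * ?B + t\<^sup>2 * ?C"
      using L2_spaceD(2)[OF f] L2_spaceD(2)[OF g] L2_integrable_mult[OF f g] by simp
    finally show ?thesis .
  qed
  have "?B\<^sup>2 \<le> ?A * ?C"
    by (rule nonneg_quadratic_imp_discriminant) (use quad in auto)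
  then have "sqrt (?B\<^sup>2) \<le> sqrt (?A * ?C)" by (rule real_sqrt_le_mono)
  then show ?thesis by (simp add: L2_norm_def real_sqrt_mult)
qed

lemma L2_norm_triangle:
  assumes f: "f \<in> L2_space S" and g: "g \<in> L2_space S"
  shows "L2_norm S (\<lambda>x. f x + g x) \<le> L2_norm S f + L2_norm S g"
proof (rule power2_le_imp_le)
  have "(L2_norm S (\<lambda>x. f x + g x))\<^sup>2 =
      (LINT x|lebesgue_on S. (f x)\<^sup>2 + (g x)\<^sup>2 + 2 * (f x * g x))"
    unfolding L2_norm_power2
    by (intro Bochner_Integration.integral_cong) (auto simp: power2_eq_square algebra_simps)
  also have "\<dots> = (L2_norm S f)\<^sup>2 + (L2_norm S g)\<^sup>2 + 2 * (LINT x|lebesgue_on S. f x * g x)"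
    unfolding L2_norm_power2
    using L2_spaceD(2)[OF f] L2_spaceD(2)[OF g] L2_integrable_mult[OF f g] by simp
  also have "\<dots> \<le> (L2_norm S f + L2_norm S g)\<^sup>2"
    using L2_Cauchy_Schwarz[OF f g] by (simp add: power2_eq_square algebra_simps)
  finally show "(L2_norm S (\<lambda>x. f x + g x))\<^sup>2 \<le> (L2_norm S f + L2_norm S g)\<^sup>2" .
qed simp

lemma L2_norm_triangle_diff:
  assumes f: "f \<in> L2_space S" and g: "g \<in> L2_space S"
  shows "L2_norm S (\<lambda>x. f x - g x) \<le> L2_norm S f + L2_norm S g"
  using L2_norm_triangle[OF f L2_space_cmult[OF g, of "-1"]] L2_norm_cmult[of S "-1" g] by simp

lemma L2_norm_abs_diff:
  assumes "f \<in> L2_space S" "g \<in> L2_space S"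
  shows "\<bar>L2_norm S f - L2_norm S g\<bar> \<le> L2_norm S (\<lambda>x. f x - g x)"
  using L2_norm_triangle[OF L2_space_diff[OF assms] assms(2)]
    L2_norm_triangle[OF L2_space_diff[OF assms(2,1)] assms(1)]
    L2_norm_minus_commute[of S f g] by simp

lemma L2_dominated:
  assumes f: "f \<in> borel_measurable (lebesgue_on S)" and h: "h \<in> L2_space S"
    and le: "\<And>x. x \<in> S \<Longrightarrow> \<bar>f x\<bar> \<le> k * \<bar>h x\<bar>" and k: "0 \<le> k"
  shows "f \<in> L2_space S" "L2_norm S f \<le> k * L2_norm S h"
proof -
  have sq: "(f x)\<^sup>2 \<le> k\<^sup>2 * (h x)\<^sup>2" if "x \<in> S" for x
    using power_mono[OF le[OF that], of 2] by (simp add: power_mult_distrib)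
  have ih: "integrable (lebesgue_on S) (\<lambda>x. k\<^sup>2 * (h x)\<^sup>2)"
    using L2_spaceD(2)[OF h] by simp
  have i: "integrable (lebesgue_on S) (\<lambda>x. (f x)\<^sup>2)"
    by (rule Bochner_Integration.integrable_bound[OF ih]) (use f sq in auto)
  with f show fL: "f \<in> L2_space S" by (simp add: L2_space_def)
  have "(LINT x|lebesgue_on S. (f x)\<^sup>2) \<le> (LINT x|lebesgue_on S. k\<^sup>2 * (h x)\<^sup>2)"
    by (rule integral_mono[OF i ih]) (use sq in auto)
  then have "(L2_norm S f)\<^sup>2 \<le> (k * L2_norm S h)\<^sup>2"
    by (simp add: power_mult_distrib L2_norm_power2)
  then show "L2_norm S f \<le> k * L2_norm S h"
    using k by (intro power2_le_imp_le[of "L2_norm S f"]) auto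
qed

lemma L2_bounded:
  assumes f: "f \<in> borel_measurable (lebesgue_on S)" and S: "S \<in> lmeasurable"
    and le: "\<And>x. x \<in> S \<Longrightarrow> \<bar>f x\<bar> \<le> k" and k: "0 \<le> k"
  shows "f \<in> L2_space S" "L2_norm S f \<le> k * sqrt (measure lebesgue S)"
proof -
  have S': "S \<in> sets lebesgue" using S by auto
  have one: "(\<lambda>x. 1) \<in> L2_space S"
    using S by (auto simp: L2_space_def integrable_restrict_space fmeasurable_def)
  have "L2_norm S (\<lambda>x. 1) = sqrt (measure lebesgue S)"
    unfolding L2_norm_def using S' by (simp add: integral_restrict_space measure_restrict_space)
  then show "f \<in> L2_space S" "L2_norm S f \<le> k * sqrt (measure lebesgue S)"
    using L2_dominated[OF f one, of k] le k by auto
qed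

lemma L2_abs:
  assumes "f \<in> L2_space S"
  shows "(\<lambda>x. \<bar>f x\<bar>) \<in> L2_space S" "L2_norm S (\<lambda>x. \<bar>f x\<bar>) = L2_norm S f"
  using assms by (auto simp: L2_space_def L2_norm_def)

lemma L1_le_L2:
  assumes S: "S \<in> lmeasurable" and w: "w \<in> L2_space S" and w0: "\<And>x. x \<notin> S \<Longrightarrow> w x = 0"
  shows "(LINT x|lebesgue. \<bar>w x\<bar>) \<le> sqrt (measure lebesgue S) * L2_norm S w"
proof -
  have one: "(\<lambda>x. 1) \<in> L2_space S"
    by (rule L2_bounded(1)[OF _ S, of _ 1]) auto
  have one': "L2_norm S (\<lambda>x. 1) \<le> 1 * sqrt (measure lebesgue S)"
    by (rule L2_bounded(2)[OF _ S]) auto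
  have eq: "indicat_real S x *\<^sub>R (\<bar>w x\<bar> * 1) = \<bar>w x\<bar>" for x using w0[of x] by (cases "x \<in> S") auto
  have "(LINT x|lebesgue_on S. \<bar>w x\<bar> * 1) = (LINT x|lebesgue. indicat_real S x *\<^sub>R (\<bar>w x\<bar> * 1))"
    by (rule integral_restrict_space) (use S in auto)
  then have "(LINT x|lebesgue. \<bar>w x\<bar>) = (LINT x|lebesgue_on S. \<bar>w x\<bar> * 1)"
    unfolding eq by simp
  also have "\<dots> \<le> L2_norm S (\<lambda>x. \<bar>w x\<bar>) * L2_norm S (\<lambda>x. 1)"
    using L2_Cauchy_Schwarz[OF L2_abs(1)[OF w] one] by linarith
  also have "\<dots> \<le> L2_norm S w * sqrt (measure lebesgue S)"
    using one' L2_abs(2)[OF w] by (simp add: mult_left_mono)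
  finally show ?thesis by (simp add: mult.commute)
qed

section \<open>Curves of square integrable functions\<close>

text \<open>A curve in $L^2(S)$, defined for all times and continuous at every time.\<close>

definition L2_curve :: "'a::euclidean_space set \<Rightarrow> (real \<Rightarrow> 'a \<Rightarrow> real) \<Rightarrow> bool" where
  "L2_curve S u \<longleftrightarrow> (\<forall>t. u t \<in> L2_space S) \<and>
     (\<forall>t. ((\<lambda>s. L2_norm S (\<lambda>x. u s x - u t x)) \<longlongrightarrow> 0) (at t))"

text \<open>The product rule for the squared norm: the difference quotient of \<open>\<parallel>w\<parallel>\<^sup>2\<close> is
  $\langle D_s, w_s + w_t\rangle = 2\langle D_s, w_t\rangle + (s-t)\,\|D_s\|^2$, where $D_s$ is the
  difference quotient of \<open>w\<close>.\<close>

lemma L2_norm_power2_has_derivative: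
  assumes w: "L2_has_derivative S UNIV w w' t"
  shows "((\<lambda>s. (L2_norm S (w s))\<^sup>2) has_real_derivative
            2 * (LINT x|lebesgue_on S. w t x * w' x)) (at t)"
proof -
  let ?ip = "\<lambda>f g. LINT x|lebesgue_on S. f x * g x"
  define D where "D s x = (w s x - w t x) / (s - t)" for s x
  have ws: "w s \<in> L2_space S" for s
    using w by (auto simp: L2_has_derivative_def)
  have w': "w' \<in> L2_space S"
    and lim: "((\<lambda>s. L2_norm S (\<lambda>x. D s x - w' x)) \<longlongrightarrow> 0) (at t)"
    using w by (auto simp: L2_has_derivative_def D_def)
  have DL: "D s \<in> L2_space S" for s
    unfolding D_def by (intro L2_space_divide L2_space_diff ws)
  have ipc: "?ip f (\<lambda>x. g x - h x) = ?ip f g - ?ip f h"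
    if "f \<in> L2_space S" "g \<in> L2_space S" "h \<in> L2_space S" for f g h
    using L2_integrable_mult[OF that(1,2)] L2_integrable_mult[OF that(1,3)]
    by (simp add: right_diff_distrib)
  have l1: "((\<lambda>s. ?ip (w t) (D s)) \<longlongrightarrow> ?ip (w t) w') (at t)"
  proof (rule Lim_transform_bound[THEN LIM_zero_cancel])
    show "\<forall>\<^sub>F s in at t. norm (?ip (w t) (D s) - ?ip (w t) w')
        \<le> norm (L2_norm S (w t) * L2_norm S (\<lambda>x. D s x - w' x))"
      using L2_Cauchy_Schwarz[OF ws L2_space_diff[OF DL w']]
      by (intro always_eventually) (auto simp: ipc[OF ws DL w', symmetric] abs_mult)
    show "((\<lambda>s. L2_norm S (w t) * L2_norm S (\<lambda>x. D s x - w' x)) \<longlongrightarrow> 0) (at t)"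
      using tendsto_mult[OF tendsto_const lim] by simp
  qed
  have l2: "((\<lambda>s. (L2_norm S (D s))\<^sup>2) \<longlongrightarrow> (L2_norm S w')\<^sup>2) (at t)"
  proof (rule tendsto_power[OF Lim_transform_bound[THEN LIM_zero_cancel]])
    show "\<forall>\<^sub>F s in at t. norm (L2_norm S (D s) - L2_norm S w')
        \<le> norm (L2_norm S (\<lambda>x. D s x - w' x))"
      using L2_norm_abs_diff[OF DL w'] by (intro always_eventually) auto
  qed (fact lim)
  have l3: "((\<lambda>s. s - t) \<longlongrightarrow> 0) (at t)"
    by (rule LIM_zero) simp
  have "((\<lambda>s. 2 * ?ip (w t) (D s) + (s - t) * (L2_norm S (D s))\<^sup>2) \<longlongrightarrow> 2 * ?ip (w t) w') (at t)"
    using tendsto_add[OF tendsto_mult[OF tendsto_const[of 2] l1] tendsto_mult[OF l3 l2]] by simp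
  moreover have "\<forall>\<^sub>F s in at t. 2 * ?ip (w t) (D s) + (s - t) * (L2_norm S (D s))\<^sup>2
      = ((L2_norm S (w s))\<^sup>2 - (L2_norm S (w t))\<^sup>2) / (s - t)"
  proof (rule eventually_at[THEN iffD2, OF exI[of _ 1]], safe)
    fix s assume "s \<noteq> t"
    have "(L2_norm S (w s))\<^sup>2 =
      (LINT x|lebesgue_on S. (w t x)\<^sup>2 + 2 * (s - t) * (w t x * D s x) + (s - t)\<^sup>2 * (D s x)\<^sup>2)"
      unfolding L2_norm_power2
    proof (rule Bochner_Integration.integral_cong[OF refl])
      fix x
      have eq: "w s x = w t x + (s - t) * D s x" using \<open>s \<noteq> t\<close> by (simp add: D_def)
      show "(w s x)\<^sup>2 = (w t x)\<^sup>2 + 2 * (s - t) * (w t x * D s x) + (s - t)\<^sup>2 * (D s x)\<^sup>2"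
        unfolding eq power2_sum power_mult_distrib by (simp add: mult_ac)
    qed
    also have "\<dots> = (L2_norm S (w t))\<^sup>2 + 2 * (s - t) * ?ip (w t) (D s)
        + (s - t)\<^sup>2 * (L2_norm S (D s))\<^sup>2"
      unfolding L2_norm_power2
      using L2_spaceD(2)[OF ws] L2_spaceD(2)[OF DL] L2_integrable_mult[OF ws DL] by simp
    finally show "2 * ?ip (w t) (D s) + (s - t) * (L2_norm S (D s))\<^sup>2
      = ((L2_norm S (w s))\<^sup>2 - (L2_norm S (w t))\<^sup>2) / (s - t)"
      using \<open>s \<noteq> t\<close> by (simp add: nonzero_eq_divide_eq) (simp add: power2_eq_square algebra_simps)
  qed simp
  ultimately show ?thesis
    unfolding has_field_derivative_iff by (rule Lim_transform_eventually)
qed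

lemma L2_has_derivative_diff:
  assumes "L2_has_derivative S UNIV u u' t" "L2_has_derivative S UNIV v v' t"
  shows "L2_has_derivative S UNIV (\<lambda>s x. u s x - v s x) (\<lambda>x. u' x - v' x) t"
proof -
  have u: "\<And>s. u s \<in> L2_space S" and v: "\<And>s. v s \<in> L2_space S"
    using assms by (auto simp: L2_has_derivative_def)
  have u': "u' \<in> L2_space S" and v': "v' \<in> L2_space S"
    using assms by (auto simp: L2_has_derivative_def)
  have lim: "((\<lambda>s. L2_norm S (\<lambda>x. (u s x - u t x) / (s - t) - u' x) +
      L2_norm S (\<lambda>x. (v s x - v t x) / (s - t) - v' x)) \<longlongrightarrow> 0) (at t)"
    by (rule tendsto_add_zero) (use assms in \<open>auto simp: L2_has_derivative_def\<close>)
  have "((\<lambda>s. L2_norm S (\<lambda>x. (u s x - v s x - (u t x - v t x)) / (s - t) - (u' x - v' x))) \<longlongrightarrow> 0)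
    (at t)"
  proof (rule Lim_null_comparison[OF _ lim])
    show "\<forall>\<^sub>F s in at t.
      norm (L2_norm S (\<lambda>x. (u s x - v s x - (u t x - v t x)) / (s - t) - (u' x - v' x)))
       \<le> L2_norm S (\<lambda>x. (u s x - u t x) / (s - t) - u' x) +
         L2_norm S (\<lambda>x. (v s x - v t x) / (s - t) - v' x)"
    proof (unfold eventually_at_filter, intro always_eventually allI impI)
      fix s :: real assume s: "s \<noteq> t"
      have "(\<lambda>x. (u s x - v s x - (u t x - v t x)) / (s - t) - (u' x - v' x)) =
        (\<lambda>x. ((u s x - u t x) / (s - t) - u' x) - ((v s x - v t x) / (s - t) - v' x))"
        by (auto simp: diff_divide_distrib)
      then show "norm (L2_norm S (\<lambda>x. (u s x - v s x - (u t x - v t x)) / (s - t) - (u' x - v' x)))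
       \<le> L2_norm S (\<lambda>x. (u s x - u t x) / (s - t) - u' x) +
         L2_norm S (\<lambda>x. (v s x - v t x) / (s - t) - v' x)"
        using u v u' v' s by (auto intro!: L2_norm_triangle_diff L2_space_diff L2_space_divide)
    qed
  qed
  then show ?thesis using u v u' v'
    by (auto simp: L2_has_derivative_def intro!: L2_space_diff)
qed

lemma L2_has_derivative_imp_curve:
  assumes u: "\<And>t. L2_has_derivative S UNIV u (u' t) t"
  shows "L2_curve S u"
proof -
  have uL: "u t \<in> L2_space S" for t using u by (auto simp: L2_has_derivative_def)
  have u'L: "u' t \<in> L2_space S" for t using u by (auto simp: L2_has_derivative_def)
  have "((\<lambda>s. L2_norm S (\<lambda>x. u s x - u t x)) \<longlongrightarrow> 0) (at t)" for t
  proof (rule Lim_null_comparison)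
    have lim: "((\<lambda>s. L2_norm S (\<lambda>x. (u s x - u t x) / (s - t) - u' t x)) \<longlongrightarrow> 0) (at t)"
      using u[of t] by (auto simp: L2_has_derivative_def)
    have "((\<lambda>s. \<bar>s - t\<bar>) \<longlongrightarrow> 0) (at t)"
      by (rule tendsto_rabs_zero, rule LIM_zero) simp
    from tendsto_mult[OF this tendsto_add[OF lim tendsto_const[of "L2_norm S (u' t)"]]]
    show "((\<lambda>s. \<bar>s - t\<bar> * (L2_norm S (\<lambda>x. (u s x - u t x) / (s - t) - u' t x) + L2_norm S (u' t)))
        \<longlongrightarrow> 0) (at t)" by simp
    show "\<forall>\<^sub>F s in at t. norm (L2_norm S (\<lambda>x. u s x - u t x))
        \<le> \<bar>s - t\<bar> * (L2_norm S (\<lambda>x. (u s x - u t x) / (s - t) - u' t x) + L2_norm S (u' t))"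
    proof (unfold eventually_at_filter, intro always_eventually allI impI)
      fix s assume "s \<noteq> t"
      let ?D = "\<lambda>x. (u s x - u t x) / (s - t)"
      have DL: "?D \<in> L2_space S" by (intro L2_space_divide L2_space_diff uL)
      have "L2_norm S (\<lambda>x. u s x - u t x) = \<bar>s - t\<bar> * L2_norm S ?D"
        using \<open>s \<noteq> t\<close> by (simp add: L2_norm_cmult[symmetric])
      also have "L2_norm S ?D \<le> L2_norm S (\<lambda>x. ?D x - u' t x) + L2_norm S (u' t)"
        using L2_norm_triangle[OF L2_space_diff[OF DL u'L] u'L, of t t] by simp
      finally show "norm (L2_norm S (\<lambda>x. u s x - u t x))
        \<le> \<bar>s - t\<bar> * (L2_norm S (\<lambda>x. ?D x - u' t x) + L2_norm S (u' t))"
        by (simp add: mult_left_mono)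
    qed
  qed
  then show ?thesis using uL by (simp add: L2_curve_def)
qed

lemma C1_L2_if_derivative:
  assumes u: "\<And>t. L2_has_derivative S UNIV u (u' t) t" and u': "L2_curve S u'"
  shows "C1_L2 S I u"
  unfolding C1_L2_def
proof (intro exI conjI ballI)
  show "L2_continuous_on S I u'"
    using u' by (auto simp: L2_curve_def L2_continuous_on_def intro: tendsto_within_subset)
  show "L2_has_derivative S I u (u' t) t" for t
    using u[of t] by (auto simp: L2_has_derivative_def intro: tendsto_within_subset)
qed

section \<open>Strong measurability and weak* convergence\<close>

lemma lebesgue_on_measurable_AE:
  fixes f g :: "'a::euclidean_space \<Rightarrow> real"
  assumes S: "S \<in> sets lebesgue" and f: "f \<in> borel_measurable (lebesgue_on S)"
    and eq: "AE x in lebesgue_on S. f x = g x"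
  shows "g \<in> borel_measurable (lebesgue_on S)"
proof -
  have "(\<lambda>x. if x \<in> S then f x else 0) \<in> borel_measurable lebesgue"
    using f S by (simp add: borel_measurable_if)
  moreover have "AE x in lebesgue. (if x \<in> S then f x else 0) = (if x \<in> S then g x else 0)"
    using eq S by (auto simp: AE_restrict_space_iff)
  ultimately have "(\<lambda>x. if x \<in> S then g x else 0) \<in> borel_measurable lebesgue"
    by (rule borel_measurable_AE)
  then show ?thesis using S by (simp add: borel_measurable_if)
qed

lemma lebesgue_on_measurable_AE_LIMSEQ:
  fixes f :: "nat \<Rightarrow> 'a::euclidean_space \<Rightarrow> real"
  assumes S: "S \<in> sets lebesgue" and f: "\<And>k. f k \<in> borel_measurable (lebesgue_on S)"
    and lim: "AE x in lebesgue_on S. (\<lambda>k. f k x) \<longlonglongrightarrow> g x"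
  shows "g \<in> borel_measurable (lebesgue_on S)"
proof (rule lebesgue_on_measurable_AE[OF S])
  have "f k \<in> borel_measurable (lebesgue_on S)" for k by (rule f)
  then show "(\<lambda>x. lim (\<lambda>k. f k x)) \<in> borel_measurable (lebesgue_on S)"
    by (rule borel_measurable_lim_metric)
  show "AE x in lebesgue_on S. lim (\<lambda>k. f k x) = g x"
    using lim by eventually_elim (rule limI)
qed

lemma L2_curve_tendsto:
  assumes u: "L2_curve S u" and p: "p \<longlonglongrightarrow> t"
  shows "(\<lambda>k. L2_norm S (\<lambda>x. u (p k) x - u t x)) \<longlonglongrightarrow> 0"
proof -
  have "isCont (\<lambda>s. L2_norm S (\<lambda>x. u s x - u t x)) t"
    using u by (simp add: L2_curve_def isCont_def L2_norm_def)
  from isCont_tendsto_compose[OF this p] show ?thesis by (simp add: L2_norm_def)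
qed

lemma L2_curve_norm_continuous:
  assumes u: "L2_curve S u"
  shows "continuous_on A (\<lambda>t. L2_norm S (u t))"
proof -
  have uL: "u t \<in> L2_space S" for t using u by (simp add: L2_curve_def)
  have "isCont (\<lambda>t. L2_norm S (u t)) t" for t
    unfolding isCont_def
  proof (rule Lim_transform_bound[THEN LIM_zero_cancel])
    show "\<forall>\<^sub>F s in at t. norm (L2_norm S (u s) - L2_norm S (u t))
        \<le> norm (L2_norm S (\<lambda>x. u s x - u t x))"
      using L2_norm_abs_diff[OF uL uL] by (intro always_eventually) auto
    show "((\<lambda>s. L2_norm S (\<lambda>x. u s x - u t x)) \<longlongrightarrow> 0) (at t)"
      using u by (simp add: L2_curve_def)
  qed
  then show ?thesis by (auto intro: continuous_at_imp_continuous_on)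
qed

lemma L2_integral_diff_bound:
  assumes "u \<in> L2_space S" "v \<in> L2_space S" "f \<in> L2_space S"
  shows "\<bar>(LINT x|lebesgue_on S. u x * f x) - (LINT x|lebesgue_on S. v x * f x)\<bar>
      \<le> L2_norm S (\<lambda>x. u x - v x) * L2_norm S f"
  using L2_Cauchy_Schwarz[OF L2_space_diff[OF assms(1,2)] assms(3)]
    L2_integrable_mult[OF assms(1,3)] L2_integrable_mult[OF assms(2,3)]
  by (simp add: left_diff_distrib)

lemma L2_curve_inner_continuous:
  assumes u: "L2_curve S u" and f: "f \<in> L2_space S"
  shows "continuous_on A (\<lambda>t. LINT x|lebesgue_on S. u t x * f x)"
proof -
  have uL: "u t \<in> L2_space S" for t using u by (simp add: L2_curve_def)
  have "isCont (\<lambda>t. LINT x|lebesgue_on S. u t x * f x) t" for t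
    unfolding isCont_def
  proof (rule Lim_transform_bound[THEN LIM_zero_cancel])
    show "\<forall>\<^sub>F s in at t. norm ((LINT x|lebesgue_on S. u s x * f x) - (LINT x|lebesgue_on S. u t x * f x))
        \<le> norm (L2_norm S (\<lambda>x. u s x - u t x) * L2_norm S f)"
      using L2_integral_diff_bound[OF uL uL f] by (intro always_eventually) auto
    show "((\<lambda>s. L2_norm S (\<lambda>x. u s x - u t x) * L2_norm S f) \<longlongrightarrow> 0) (at t)"
      using u by (intro tendsto_mult_left_zero) (simp add: L2_curve_def)
  qed
  then show ?thesis by (auto intro: continuous_at_imp_continuous_on)
qed

text \<open>The approximating simple functions sample the curve at the left end points of a uniform
  partition of mesh \<open>1 / (k + 1)\<close>.\<close>

lemma L2_curve_strongly_measurable: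
  fixes a b :: real
  assumes u: "L2_curve S u"
  shows "L2_strongly_measurable S {a..b} u"
proof -
  have uL: "u t \<in> L2_space S" for t using u by (simp add: L2_curve_def)
  define p where "p k i = a + real i / real (Suc k)" for k i :: nat
  define A where "A k i = {a..b} \<inter> {p k i ..< p k (Suc i)}" for k i
  define n where "n k = Suc (nat \<lfloor>(b - a) * real (Suc k)\<rfloor>)" for k
  define s where "s k = (\<lambda>t x. \<Sum>i<n k. indicator (A k i) t * u (p k i) x)" for k
  define r where "r k t = nat \<lfloor>(t - a) * real (Suc k)\<rfloor>" for k t
  have "L2_simple_function S {a..b} (s k)" for k
    unfolding L2_simple_function_def
  proof (intro exI conjI allI impI)
    show "A k i \<in> sets (lebesgue_on {a..b})" for i
      by (auto simp: A_def sets_restrict_space)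
    show "s k = (\<lambda>t x. \<Sum>i<n k. indicator (A k i) t * u (p k i) x)"
      by (simp add: s_def)
  qed (rule uL)
  moreover have "(\<lambda>k. L2_norm S (\<lambda>x. s k t x - u t x)) \<longlonglongrightarrow> 0" if t: "t \<in> {a..b}" for t
  proof -
    have r: "real (r k t) \<le> (t - a) * real (Suc k)" "(t - a) * real (Suc k) < real (r k t) + 1" for k
      using t by (auto simp: r_def of_nat_nat)
    have rn: "r k t < n k" for k
    proof -
      have "(t - a) * real (Suc k) \<le> (b - a) * real (Suc k)"
        using t by (intro mult_right_mono) auto
      then show ?thesis unfolding r_def n_def by (simp add: less_Suc_eq_le nat_mono floor_mono)
    qed
    have Ai: "t \<in> A k i \<longleftrightarrow> i = r k t" for k i
    proof -
      have "t \<in> A k i \<longleftrightarrow> real i \<le> (t - a) * real (Suc k) \<and> (t - a) * real (Suc k) < real i + 1"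
        using t by (simp add: A_def p_def field_simps)
      also have "\<dots> \<longleftrightarrow> i = r k t"
        using r[of k] by (auto simp del: of_nat_Suc)
      finally show ?thesis .
    qed
    have "s k t x = u (p k (r k t)) x" for k x
    proof -
      have "s k t x = (\<Sum>i<n k. if i = r k t then u (p k i) x else 0)"
        unfolding s_def by (intro sum.cong) (auto simp: indicator_def Ai)
      then show ?thesis using rn[of k] by simp
    qed
    moreover have "(\<lambda>k. p k (r k t)) \<longlonglongrightarrow> t"
    proof (rule Lim_transform_bound[THEN LIM_zero_cancel])
      have "\<bar>p k (r k t) - t\<bar> \<le> 1 / real (Suc k)" for k
      proof -
        have "p k (r k t) - t = (real (r k t) - (t - a) * real (Suc k)) / real (Suc k)"
          by (simp add: p_def diff_divide_distrib del: of_nat_Suc)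
        also have "\<bar>\<dots>\<bar> \<le> 1 / real (Suc k)"
          unfolding abs_divide using r[of k] by (intro frac_le) auto
        finally show ?thesis .
      qed
      then show "\<forall>\<^sub>F k in sequentially. norm (p k (r k t) - t) \<le> norm (inverse (real (Suc k)))"
        by (auto simp: inverse_eq_divide simp del: of_nat_Suc)
    qed (rule LIMSEQ_inverse_real_of_nat)
    ultimately show ?thesis using L2_curve_tendsto[OF u] by simp
  qed
  ultimately show ?thesis
    unfolding L2_strongly_measurable_def using uL by (intro conjI exI[of _ s] AE_I2) auto
qed

lemma L2_curve_bounded:
  fixes a b :: real
  assumes u: "L2_curve S u"
  shows "\<exists>C. \<forall>t\<in>{a..b}. L2_norm S (u t) \<le> C"
proof -
  have "bounded ((\<lambda>t. L2_norm S (u t)) ` {a..b})"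
    by (intro compact_imp_bounded compact_continuous_image L2_curve_norm_continuous u) simp
  then obtain C where "\<forall>y\<in>(\<lambda>t. L2_norm S (u t)) ` {a..b}. norm y \<le> C"
    unfolding bounded_iff by blast
  then have "\<forall>t\<in>{a..b}. L2_norm S (u t) \<le> C" by simp
  then show ?thesis by (rule exI)
qed

lemma L2_curve_Linf:
  assumes u: "L2_curve S u"
  shows "Linf_L2 S {a..b} u"
proof -
  obtain C where "\<forall>t\<in>{a..b}. L2_norm S (u t) \<le> C"
    using L2_curve_bounded[OF u] by blast
  then show ?thesis
    using L2_curve_strongly_measurable[OF u] by (auto simp: Linf_L2_def intro!: exI[of _ C])
qed

lemma L2_curve_pairing_integrable:
  assumes u: "L2_curve S u" and \<phi>: "L1_L2 S {a..b} \<phi>"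
  shows "integrable (lebesgue_on {a..b}) (\<lambda>t. LINT x|lebesgue_on S. u t x * \<phi> t x)"
proof -
  have uL: "u t \<in> L2_space S" for t using u by (simp add: L2_curve_def)
  have \<phi>L: "AE t in lebesgue_on {a..b}. \<phi> t \<in> L2_space S"
    and \<phi>i: "integrable (lebesgue_on {a..b}) (\<lambda>t. L2_norm S (\<phi> t))"
    using \<phi> by (auto simp: L1_L2_def L2_strongly_measurable_def)
  obtain s where s: "\<And>k. L2_simple_function S {a..b} (s k)"
    and lim: "AE t in lebesgue_on {a..b}. (\<lambda>k. L2_norm S (\<lambda>x. s k t x - \<phi> t x)) \<longlonglongrightarrow> 0"
    using \<phi> by (auto simp: L1_L2_def L2_strongly_measurable_def)
  have sL: "s k t \<in> L2_space S" for k t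
    using s[of k] by (auto simp: L2_simple_function_def intro!: L2_space_sum L2_space_cmult)
  obtain C where C: "\<And>t. t \<in> {a..b} \<Longrightarrow> L2_norm S (u t) \<le> C"
    using L2_curve_bounded[OF u] by blast
  have meas: "(\<lambda>t. LINT x|lebesgue_on S. u t x * \<phi> t x) \<in> borel_measurable (lebesgue_on {a..b})"
  proof (rule lebesgue_on_measurable_AE_LIMSEQ)
    fix k
    obtain n :: nat and A f where A: "\<And>i. i < n \<Longrightarrow> A i \<in> sets (lebesgue_on {a..b})"
      and f: "\<And>i. i < n \<Longrightarrow> f i \<in> L2_space S"
      and sk: "s k = (\<lambda>t x. \<Sum>i<n. indicator (A i) t * f i x)"
      using s[of k] by (auto simp: L2_simple_function_def)
    have "(LINT x|lebesgue_on S. u t x * s k t x) =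
        (\<Sum>i<n. indicator (A i) t * (LINT x|lebesgue_on S. u t x * f i x))" for t
    proof -
      have "(LINT x|lebesgue_on S. u t x * s k t x) =
        (LINT x|lebesgue_on S. (\<Sum>i<n. indicator (A i) t * (u t x * f i x)))"
        unfolding sk sum_distrib_left
        by (intro Bochner_Integration.integral_cong sum.cong refl mult.left_commute)
      also have "\<dots> = (\<Sum>i<n. LINT x|lebesgue_on S. indicator (A i) t * (u t x * f i x))"
        by (intro Bochner_Integration.integral_sum integrable_mult_right L2_integrable_mult uL f) auto
      finally show ?thesis by simp
    qed
    moreover have "(\<lambda>t. \<Sum>i<n. indicator (A i) t * (LINT x|lebesgue_on S. u t x * f i x))
        \<in> borel_measurable (lebesgue_on {a..b})"
      using A f by (intro borel_measurable_sum borel_measurable_times borel_measurable_indicator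
          continuous_imp_measurable_on_sets_lebesgue L2_curve_inner_continuous[OF u]) auto
    ultimately show "(\<lambda>t. LINT x|lebesgue_on S. u t x * s k t x)
        \<in> borel_measurable (lebesgue_on {a..b})"
      by simp
  next
    show "AE t in lebesgue_on {a..b}. (\<lambda>k. LINT x|lebesgue_on S. u t x * s k t x)
        \<longlonglongrightarrow> (LINT x|lebesgue_on S. u t x * \<phi> t x)"
      using lim \<phi>L
    proof eventually_elim
      case (elim t)
      show ?case
      proof (rule Lim_transform_bound[THEN LIM_zero_cancel])
        show "\<forall>\<^sub>F k in sequentially.
          norm ((LINT x|lebesgue_on S. u t x * s k t x) - (LINT x|lebesgue_on S. u t x * \<phi> t x))
            \<le> norm (L2_norm S (\<lambda>x. s k t x - \<phi> t x) * L2_norm S (u t))"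
          using L2_integral_diff_bound[OF sL elim(2) uL]
          by (intro always_eventually) (auto simp: mult.commute)
        show "(\<lambda>k. L2_norm S (\<lambda>x. s k t x - \<phi> t x) * L2_norm S (u t)) \<longlonglongrightarrow> 0"
          using elim(1) by (rule tendsto_mult_left_zero)
      qed
    qed
  qed simp
  show ?thesis
  proof (rule Bochner_Integration.integrable_bound[OF _ meas])
    show "integrable (lebesgue_on {a..b}) (\<lambda>t. C * L2_norm S (\<phi> t))"
      using \<phi>i by simp
    have "AE t in lebesgue_on {a..b}. t \<in> {a..b}"
      by (rule AE_I2) simp
    then show "AE t in lebesgue_on {a..b}. norm (LINT x|lebesgue_on S. u t x * \<phi> t x)
        \<le> norm (C * L2_norm S (\<phi> t))"
      using \<phi>L
    proof eventually_elim
      case (elim t)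
      have "\<bar>LINT x|lebesgue_on S. u t x * \<phi> t x\<bar> \<le> C * L2_norm S (\<phi> t)"
        using L2_Cauchy_Schwarz[OF uL elim(2)] mult_right_mono[OF C[OF elim(1)] L2_norm_nonneg]
        by (rule order_trans)
      then show ?case by simp
    qed
  qed
qed

lemma uniform_imp_weakstar:
  fixes u :: "real \<Rightarrow> real \<Rightarrow> 'a::euclidean_space \<Rightarrow> real"
  assumes u: "\<forall>\<^sub>F d in F. L2_curve S (u d)" and v: "L2_curve S v"
    and conv: "\<And>e. e > 0 \<Longrightarrow> \<forall>\<^sub>F d in F. \<forall>t\<in>{a..b}. L2_norm S (\<lambda>x. u d t x - v t x) \<le> e"
  shows "Linf_L2_weakstar_tendsto S {a..b} u v F"
  unfolding Linf_L2_weakstar_tendsto_def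
proof (intro conjI allI impI L2_curve_Linf[OF v])
  show "\<forall>\<^sub>F d in F. Linf_L2 S {a..b} (u d)"
    using u by eventually_elim (rule L2_curve_Linf)
  fix \<phi> assume \<phi>: "L1_L2 S {a..b} \<phi>"
  let ?I = "lebesgue_on {a..b}"
  let ?P = "\<lambda>w t. LINT x|lebesgue_on S. w t x * \<phi> t x"
  have vL: "v t \<in> L2_space S" for t using v by (simp add: L2_curve_def)
  have \<phi>L: "AE t in ?I. \<phi> t \<in> L2_space S"
    and \<phi>i: "integrable ?I (\<lambda>t. L2_norm S (\<phi> t))"
    using \<phi> by (auto simp: L1_L2_def L2_strongly_measurable_def)
  define N where "N = (LINT t|?I. L2_norm S (\<phi> t))"
  have N: "N \<ge> 0" unfolding N_def by (intro integral_nonneg_AE) simp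
  show "((\<lambda>d. LINT t|?I. ?P (u d) t) \<longlongrightarrow> (LINT t|?I. ?P v t)) F"
  proof (rule tendstoI)
    fix e :: real assume "e > 0"
    then have "e / (N + 1) > 0" using N by simp
    from conv[OF this] u
    show "\<forall>\<^sub>F d in F. dist (LINT t|?I. ?P (u d) t) (LINT t|?I. ?P v t) < e"
    proof eventually_elim
      case (elim d)
      have ud: "u d t \<in> L2_space S" for t using elim(2) by (simp add: L2_curve_def)
      note i = L2_curve_pairing_integrable[OF elim(2) \<phi>] L2_curve_pairing_integrable[OF v \<phi>]
      have "AE t in ?I. t \<in> {a..b}" by (rule AE_I2) simp
      then have bound: "AE t in ?I. norm (?P (u d) t - ?P v t) \<le> e / (N + 1) * L2_norm S (\<phi> t)"
        using \<phi>L
      proof eventually_elim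
        case (elim t)
        then have "L2_norm S (\<lambda>x. u d t x - v t x) * L2_norm S (\<phi> t) \<le> e / (N + 1) * L2_norm S (\<phi> t)"
          using \<open>\<forall>t\<in>{a..b}. _ t\<close> by (intro mult_right_mono) auto
        with L2_integral_diff_bound[OF ud vL elim(2), of t t] show ?case
          unfolding real_norm_def by (rule order_trans)
      qed
      have "\<bar>(LINT t|?I. ?P (u d) t) - (LINT t|?I. ?P v t)\<bar> = norm (LINT t|?I. ?P (u d) t - ?P v t)"
        using i by simp
      also have "\<dots> \<le> (LINT t|?I. norm (?P (u d) t - ?P v t))"
        by (rule integral_norm_bound)
      also have "\<dots> \<le> (LINT t|?I. e / (N + 1) * L2_norm S (\<phi> t))"
        using \<phi>i i bound by (intro integral_mono_AE) auto
      also have "\<dots> = e * (N / (N + 1))" by (simp add: N_def)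
      also have "\<dots> < e * 1" using N \<open>e > 0\<close> by (intro mult_strict_left_mono) auto
      finally show ?case by (simp add: dist_real_def)
    qed
  qed
qed

section \<open>Ordinary differential equations in Banach spaces\<close>

text \<open>An antiderivative on the whole line, with values in a Banach space.\<close>

lemma ex_antiderivative:
  fixes f :: "real \<Rightarrow> 'b::banach"
  assumes f: "continuous_on UNIV f"
  shows "\<exists>G. G 0 = 0 \<and> (\<forall>t. (G has_vector_derivative f t) (at t))"
proof -
  define G where "G t = integral {0..t} f - integral {t..0} f" for t
  have G: "G t = integral {-T..t} f - integral {-T..0} f" if "t \<in> {-T<..<T}" for t T
  proof -
    have i: "f integrable_on {a..b}" for a b
      by (intro integrable_continuous_real continuous_on_subset[OF f]) simp
    show ?thesis
    proof (cases "t \<ge> 0")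
      case True
      then have "integral {t..0} f = 0" by (cases "t = 0") auto
      then show ?thesis
        using Henstock_Kurzweil_Integration.integral_combine[OF _ _ i, of "-T" 0 t] True that
        by (simp add: G_def algebra_simps)
    next
      case False
      then show ?thesis
        using Henstock_Kurzweil_Integration.integral_combine[OF _ _ i, of "-T" t 0] that
        by (simp add: G_def algebra_simps)
    qed
  qed
  have "(G has_vector_derivative f t) (at t)" for t
  proof -
    define T where "T = \<bar>t\<bar> + 1"
    have t: "t \<in> {-T<..<T}" by (auto simp: T_def)
    have "((\<lambda>u. integral {-T..u} f) has_vector_derivative f t) (at t within {-T..T})"
      using t by (intro integral_has_vector_derivative continuous_on_subset[OF f]) auto
    then have "((\<lambda>u. integral {-T..u} f) has_vector_derivative f t) (at t)"
      using t by (simp add: at_within_Icc_at)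
    then have "((\<lambda>u. integral {-T..u} f - integral {-T..0} f) has_vector_derivative f t) (at t)"
      by (intro has_vector_derivative_diff[where g'=0, simplified]) simp_all
    then show ?thesis
      by (rule has_vector_derivative_transform_within_open[where S="{-T<..<T}"]) (use t G in auto)
  qed
  moreover have "G 0 = 0" by (simp add: G_def)
  ultimately show ?thesis by blast
qed

lemma norm_le_exp_if_derivative_le_exp:
  fixes G :: "real \<Rightarrow> 'b::real_normed_vector"
  assumes G0: "G 0 = 0" and G: "\<And>t. (G has_vector_derivative f t) (at t)"
    and bound: "\<And>s. norm (f s) \<le> B * exp (K * \<bar>s\<bar>)" and K: "K > 0"
  shows "norm (G t) \<le> B / K * exp (K * \<bar>t\<bar>)"
proof -
  have B: "B \<ge> 0" using bound[of 0] order_trans[OF norm_ge_zero] by fastforce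
  have pos: "norm (H t) \<le> B / K * exp (K * \<bar>t\<bar>)"
    if "t > 0" "H 0 = 0" and H: "\<And>t. (H has_vector_derivative h t) (at t)"
      and h: "\<And>s. norm (h s) \<le> B * exp (K * \<bar>s\<bar>)" for t and H h :: "real \<Rightarrow> 'b"
  proof -
    have "norm (H t - H 0) \<le> B / K * exp (K * t) - B / K * exp (K * 0)"
    proof (rule differentiable_bound_general[OF \<open>t > 0\<close>])
      show "continuous_on {0..t} H"
        by (intro continuous_at_imp_continuous_on ballI has_vector_derivative_continuous[OF H])
      show "continuous_on {0..t} (\<lambda>t. B / K * exp (K * t))"
        by (intro continuous_intros)
      show "((\<lambda>t. B / K * exp (K * t)) has_vector_derivative B * exp (K * x)) (at x)" for x
        unfolding has_real_derivative_iff_has_vector_derivative[symmetric]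
        by (rule derivative_eq_intros refl | use K in simp)+
      show "norm (h x) \<le> B * exp (K * x)" if "0 < x" for x
        using h[of x] that by simp
    qed (rule H)
    then have "norm (H t) \<le> B / K * exp (K * t) - B / K" using \<open>H 0 = 0\<close> by simp
    also have "\<dots> \<le> B / K * exp (K * \<bar>t\<bar>)" using B K \<open>t > 0\<close> by simp
    finally show ?thesis .
  qed
  consider "t > 0" | "t = 0" | "t < 0" by linarith
  then show ?thesis
  proof cases
    case 1
    then show ?thesis using pos[OF _ G0 G bound] by blast
  next
    case 2
    then show ?thesis using G0 B K by simp
  next
    case 3
    have "((\<lambda>x. - x) has_vector_derivative (- 1 :: real)) (at t)" for t
      unfolding has_real_derivative_iff_has_vector_derivative[symmetric]
      by (auto intro!: derivative_eq_intros)
    from vector_diff_chain_at[OF this G]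
    have "((\<lambda>t. G (- t)) has_vector_derivative - f (- t)) (at t)" for t
      by (simp add: o_def)
    from pos[of "- t" "\<lambda>t. G (- t)", OF _ _ this] 3 G0 bound[of "- s" for s] show ?thesis
      by simp
  qed
qed

text \<open>Global Picard-Lindeloef. The Picard operator is a contraction on bounded continuous curves
  after the substitution \<open>v t = exp (K * \<bar>t\<bar>) *\<^sub>R w t\<close> with \<open>K\<close> larger than the Lipschitz
  constant, so that one fixed point gives the solution for all times.\<close>

lemma Lipschitz_ode_global_solution:
  fixes F :: "'b::banach \<Rightarrow> 'b"
  assumes lip: "\<And>x y. norm (F x - F y) \<le> L * norm (x - y)" and L: "L \<ge> 0"
  shows "\<exists>v. v 0 = x0 \<and> (\<forall>t. (v has_vector_derivative F (v t)) (at t))"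
proof -
  define K where "K = L + 1"
  have K: "K > 0" using L by (simp add: K_def)
  \<comment> \<open>The weight \<open>E\<close> of the substitution \<open>v t = E t *\<^sub>R w t\<close>.\<close>
  define E where "E t = exp (K * \<bar>t\<bar>)" for t :: real
  have E: "E t \<ge> 1" "E t > 0" for t using K by (auto simp: E_def)
  have contE: "continuous_on UNIV E" unfolding E_def by (intro continuous_intros)
  have contF: "continuous_on UNIV F"
    by (rule lipschitz_on_continuous_on[of L])
      (auto intro!: lipschitz_onI simp: dist_norm lip L)
  define P where "P w G \<longleftrightarrow> G 0 = 0 \<and>
      (\<forall>t. (G has_vector_derivative F (E t *\<^sub>R apply_bcontfun w t)) (at t))"
    for w :: "real \<Rightarrow>\<^sub>C 'b" and G
  have "\<exists>G. P w G" for w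
    unfolding P_def
    by (intro ex_antiderivative continuous_on_compose2[OF contF] continuous_intros
        continuous_on_subset[OF contE]) auto
  then obtain G where G: "P w (G w)" for w by metis
  have G0: "G w 0 = 0" and Gd: "(G w has_vector_derivative F (E t *\<^sub>R apply_bcontfun w t)) (at t)"
    for w t using G by (auto simp: P_def)
  have contG: "continuous_on UNIV (G w)" for w
    by (intro continuous_at_imp_continuous_on ballI has_vector_derivative_continuous[OF Gd])
  have Fb: "norm (F x) \<le> norm (F 0) + L * norm x" for x
    using lip[of x 0] norm_triangle_sub[of "F x" "F 0"] by simp
  have Gb: "norm (G w t) \<le> (norm (F 0) + L * norm w) / K * E t" for w t
    unfolding E_def
  proof (rule norm_le_exp_if_derivative_le_exp[OF G0 Gd _ K])
    fix s
    have "norm (F (E s *\<^sub>R apply_bcontfun w s)) \<le> norm (F 0) + L * (E s * norm (apply_bcontfun w s))"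
      using Fb[of "E s *\<^sub>R apply_bcontfun w s"] E(2)[of s] by simp
    also have "\<dots> \<le> norm (F 0) * E s + L * (E s * norm w)"
      using E(1)[of s] L
      by (intro add_mono mult_left_mono norm_bounded) (auto simp: mult_le_cancel_left1)
    finally show "norm (F (E s *\<^sub>R apply_bcontfun w s)) \<le> (norm (F 0) + L * norm w) * exp (K * \<bar>s\<bar>)"
      by (simp add: E_def algebra_simps)
  qed
  have Gl: "norm (G w t - G w' t) \<le> (L * dist w w') / K * E t" for w w' t
    unfolding E_def
  proof (rule norm_le_exp_if_derivative_le_exp[OF _ _ _ K])
    show "G w 0 - G w' 0 = 0" by (simp add: G0)
    show "((\<lambda>t. G w t - G w' t) has_vector_derivative
        F (E t *\<^sub>R apply_bcontfun w t) - F (E t *\<^sub>R apply_bcontfun w' t)) (at t)" for t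
      by (intro has_vector_derivative_diff Gd)
    fix s
    have "norm (F (E s *\<^sub>R apply_bcontfun w s) - F (E s *\<^sub>R apply_bcontfun w' s))
        \<le> L * norm (E s *\<^sub>R apply_bcontfun w s - E s *\<^sub>R apply_bcontfun w' s)" by (rule lip)
    also have "\<dots> = L * (E s * dist (apply_bcontfun w s) (apply_bcontfun w' s))"
      using E(2)[of s] by (simp add: scaleR_diff_right[symmetric] dist_norm)
    also have "\<dots> \<le> L * (E s * dist w w')"
      using L E(2)[of s] by (intro mult_left_mono dist_bounded) auto
    finally show "norm (F (E s *\<^sub>R apply_bcontfun w s) - F (E s *\<^sub>R apply_bcontfun w' s))
        \<le> L * dist w w' * exp (K * \<bar>s\<bar>)" by (simp add: E_def algebra_simps)
  qed
  define T where "T w = Bcontfun (\<lambda>t. (x0 + G w t) /\<^sub>R E t)" for w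
  have T: "apply_bcontfun (T w) = (\<lambda>t. (x0 + G w t) /\<^sub>R E t)" for w
    unfolding T_def
  proof (rule Bcontfun_inverse, rule bcontfun_normI)
    show "continuous_on UNIV (\<lambda>t. (x0 + G w t) /\<^sub>R E t)"
      using E(2) by (intro continuous_intros contE contG) (auto simp: less_le)
    fix t
    have "norm (x0 + G w t) \<le> norm x0 * E t + (norm (F 0) + L * norm w) / K * E t"
      using E(1)[of t] Gb[of w t] mult_left_mono[OF E(1)[of t], of "norm x0"]
      by (intro norm_triangle_le) auto
    also have "\<dots> = (norm x0 + (norm (F 0) + L * norm w) / K) * E t" by (simp add: algebra_simps)
    finally have "norm (x0 + G w t) / E t \<le> norm x0 + (norm (F 0) + L * norm w) / K"
      using E(2)[of t] pos_divide_le_eq by blast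
    moreover have "norm ((x0 + G w t) /\<^sub>R E t) = norm (x0 + G w t) / E t"
      unfolding norm_scaleR using E(2)[of t] by (simp add: divide_inverse mult.commute)
    ultimately show "norm ((x0 + G w t) /\<^sub>R E t) \<le> norm x0 + (norm (F 0) + L * norm w) / K"
      by simp
  qed
  have "dist (T w) (T w') \<le> L / K * dist w w'" for w w'
  proof (rule dist_bound)
    fix t
    have "dist (apply_bcontfun (T w) t) (apply_bcontfun (T w') t) = norm (G w t - G w' t) / E t"
      using E(2)[of t]
      by (simp add: T dist_norm scaleR_diff_right[symmetric] divide_inverse mult.commute)
    also have "\<dots> \<le> (L * dist w w') / K * E t / E t"
      using Gl[of w t w'] E(2)[of t] by (intro divide_right_mono) auto
    finally show "dist (apply_bcontfun (T w) t) (apply_bcontfun (T w') t) \<le> L / K * dist w w'"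
      using E(2)[of t] by simp
  qed
  moreover have "0 \<le> L / K" "L / K < 1" using L by (auto simp: K_def)
  ultimately obtain w where w: "T w = w"
    using banach_fix_type[of "L / K" T] by blast
  define v where "v t = x0 + G w t" for t
  have v: "E t *\<^sub>R apply_bcontfun w t = v t" for t
    using arg_cong[OF T[of w], of "\<lambda>f. E t *\<^sub>R f t"] E(2)[of t] by (simp add: w v_def)
  have "(v has_vector_derivative F (v t)) (at t)" for t
    using Gd[of w t] unfolding v v_def[abs_def] by (auto intro!: derivative_eq_intros)
  moreover have "v 0 = x0" by (simp add: v_def G0)
  ultimately show ?thesis by blast
qed

text \<open>The space in which the limit equation is solved, with the supremum norm.\<close>

instance bcontfun :: (metric_space, banach) banach ..

text \<open>Gronwall's inequality for differential inequalities on both sides of \<open>0\<close>.\<close>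

lemma Gronwall_two_sided:
  fixes \<phi> :: "real \<Rightarrow> real"
  assumes \<phi>: "\<And>t. (\<phi> has_real_derivative \<phi>' t) (at t)" and \<phi>0: "\<phi> 0 = 0"
    and le: "\<And>t. t \<in> {-T..T} \<Longrightarrow> \<bar>\<phi>' t\<bar> \<le> K * \<phi> t + \<eta>" and K: "K > 0" and \<eta>: "\<eta> \<ge> 0"
    and t: "t \<in> {-T..T}"
  shows "\<phi> t \<le> \<eta> / K * exp (K * T)"
proof -
  have pos: "\<psi> t \<le> \<eta> / K * exp (K * T)"
    if \<psi>: "\<And>t. (\<psi> has_real_derivative \<psi>' t) (at t)" and \<psi>0: "\<psi> 0 = 0"
      and le: "\<And>t. t \<in> {0..T} \<Longrightarrow> \<psi>' t \<le> K * \<psi> t + \<eta>" and t: "t \<in> {0..T}" for \<psi> \<psi>' t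
  proof -
    have "exp (- K * t) * (\<psi> t + \<eta> / K) \<le> exp (- K * 0) * (\<psi> 0 + \<eta> / K)"
    proof (rule DERIV_nonpos_imp_nonincreasing[where f="\<lambda>t. exp (- K * t) * (\<psi> t + \<eta> / K)"])
      show "0 \<le> t" using t by simp
      fix x assume x: "0 \<le> x" "x \<le> t"
      have "((\<lambda>t. exp (- K * t) * (\<psi> t + \<eta> / K)) has_real_derivative
          exp (- K * x) * \<psi>' x + (\<psi> x + \<eta> / K) * (exp (- K * x) * (- K))) (at x)"
        by (rule derivative_eq_intros \<psi> refl | simp)+
      also have "exp (- K * x) * \<psi>' x + (\<psi> x + \<eta> / K) * (exp (- K * x) * (- K)) =
          exp (- K * x) * (\<psi>' x - (K * \<psi> x + \<eta>))"
        using K by (simp add: algebra_simps)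
      finally have d: "((\<lambda>t. exp (- K * t) * (\<psi> t + \<eta> / K)) has_real_derivative
          exp (- K * x) * (\<psi>' x - (K * \<psi> x + \<eta>))) (at x)" .
      have "exp (- K * x) * (\<psi>' x - (K * \<psi> x + \<eta>)) \<le> 0"
        using le[of x] x t by (intro mult_nonneg_nonpos) auto
      with d show "\<exists>y. ((\<lambda>t. exp (- K * t) * (\<psi> t + \<eta> / K)) has_real_derivative y) (at x) \<and> y \<le> 0"
        by blast
    qed
    then have "exp (- (K * t)) * (\<psi> t + \<eta> / K) \<le> \<eta> / K" by (simp add: \<psi>0)
    then have "exp (K * t) * (exp (- (K * t)) * (\<psi> t + \<eta> / K)) \<le> exp (K * t) * (\<eta> / K)"
      by (intro mult_left_mono) auto
    then have "\<psi> t + \<eta> / K \<le> exp (K * t) * (\<eta> / K)"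
      by (simp add: mult.assoc[symmetric] exp_add[symmetric])
    also have "\<dots> \<le> exp (K * T) * (\<eta> / K)"
      using t K \<eta> by (intro mult_right_mono) auto
    finally have "\<psi> t + \<eta> / K \<le> exp (K * T) * (\<eta> / K)" .
    moreover have "0 \<le> \<eta> / K" using K \<eta> by simp
    ultimately show ?thesis by (simp add: mult.commute)
  qed
  show ?thesis
  proof (cases "t \<ge> 0")
    case True
    show ?thesis
    proof (rule pos[OF \<phi> \<phi>0])
      show "\<phi>' s \<le> K * \<phi> s + \<eta>" if "s \<in> {0..T}" for s
        using le[of s] that by auto
    qed (use True t in auto)
  next
    case False
    have d: "((\<lambda>t. \<phi> (- t)) has_real_derivative - \<phi>' (- s)) (at s)" for s
    proof -
      have "((\<lambda>x. - x) has_real_derivative (- 1)) (at s)" by (auto intro!: derivative_eq_intros)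
      from DERIV_chain2[OF \<phi> this] show ?thesis by simp
    qed
    have "\<phi> (- (- t)) \<le> \<eta> / K * exp (K * T)"
    proof (rule pos[OF d])
      show "- \<phi>' (- s) \<le> K * \<phi> (- s) + \<eta>" if "s \<in> {0..T}" for s
        using le[of "- s"] that by auto
    qed (use False t \<phi>0 in auto)
    then show ?thesis by simp
  qed
qed

section \<open>Functions with bounded support\<close>

lemma integrable_bounded_support:
  fixes w :: "'a::euclidean_space \<Rightarrow> real"
  assumes "w \<in> borel_measurable lebesgue" and S: "S \<in> lmeasurable"
    and w0: "\<And>x. x \<notin> S \<Longrightarrow> w x = 0" and wk: "\<And>x. \<bar>w x\<bar> \<le> k"
  shows "integrable lebesgue w"
proof (rule Bochner_Integration.integrable_bound)
  show "integrable lebesgue (\<lambda>x. k * indicat_real S x)"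
    using S by (intro integrable_mult_right integrable_real_indicator) (auto simp: fmeasurable_def)
  show "AE x in lebesgue. norm (w x) \<le> norm (k * indicat_real S x)"
  proof (rule AE_I2)
    fix x show "norm (w x) \<le> norm (k * indicat_real S x)"
      using w0[of x] wk[of x] by (cases "x \<in> S") auto
  qed
qed fact

text \<open>An element of $L^2(S)$ extended by zero.\<close>

lemma L2_zero_extension:
  fixes w :: "'a::euclidean_space \<Rightarrow> real"
  assumes S: "S \<in> lmeasurable" and w: "w \<in> L2_space S" and w0: "\<And>x. x \<notin> S \<Longrightarrow> w x = 0"
  shows "w \<in> borel_measurable lebesgue" "integrable lebesgue (\<lambda>x. (w x)\<^sup>2)"
    "(LINT x|lebesgue. (w x)\<^sup>2) = (L2_norm S w)\<^sup>2" "integrable lebesgue w"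
proof -
  have S': "S \<in> sets lebesgue" using S by auto
  have "(\<lambda>x. if x \<in> S then w x else 0) \<in> borel_measurable lebesgue"
    using L2_spaceD(1)[OF w] S' by (simp add: borel_measurable_if)
  moreover have "(\<lambda>x. if x \<in> S then w x else 0) = w" using w0 by auto
  ultimately show m: "w \<in> borel_measurable lebesgue" by simp
  have eq: "(\<lambda>x. indicat_real S x *\<^sub>R (w x)\<^sup>2) = (\<lambda>x. (w x)\<^sup>2)"
  proof
    fix x show "indicat_real S x *\<^sub>R (w x)\<^sup>2 = (w x)\<^sup>2" using w0[of x] by (cases "x \<in> S") auto
  qed
  show i: "integrable lebesgue (\<lambda>x. (w x)\<^sup>2)"
    using L2_spaceD(2)[OF w] S' by (simp add: integrable_restrict_space eq[simplified])
  show "(LINT x|lebesgue. (w x)\<^sup>2) = (L2_norm S w)\<^sup>2"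
    unfolding L2_norm_power2 using S' by (simp add: integral_restrict_space eq[simplified])
  show "integrable lebesgue w"
  proof (rule Bochner_Integration.integrable_bound[OF _ m])
    show "integrable lebesgue (\<lambda>x. (w x)\<^sup>2 + indicat_real S x)"
      using S i by (intro Bochner_Integration.integrable_add integrable_real_indicator) (auto simp: fmeasurable_def)
    have "\<bar>r\<bar> \<le> r\<^sup>2 + 1" for r :: real
      using sum_squares_bound[of "\<bar>r\<bar>" 1] abs_ge_zero[of r] by simp
    then show "AE x in lebesgue. norm (w x) \<le> norm ((w x)\<^sup>2 + indicat_real S x)"
      by (intro AE_I2) (use w0 in \<open>auto simp: indicator_def\<close>)
  qed
qed

section \<open>Convolution with a bounded continuous kernel\<close>

lemma convolution_bounded_continuous:
  fixes J w :: "'a::euclidean_space \<Rightarrow> real"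
  assumes J: "continuous_on UNIV J" and Jk: "\<And>x. \<bar>J x\<bar> \<le> k" and w: "integrable lebesgue w"
  shows "integrable lebesgue (\<lambda>y. J (x - y) * w y)"
    and "continuous_on UNIV (\<lambda>x. LINT y|lebesgue. J (x - y) * w y)"
    and "\<bar>LINT y|lebesgue. J (x - y) * w y\<bar> \<le> k * (LINT y|lebesgue. \<bar>w y\<bar>)"
proof -
  have Jm: "(\<lambda>y. J (x - y)) \<in> borel_measurable lebesgue" for x
  proof -
    have "(\<lambda>y. J (x - y)) \<in> borel_measurable borel"
      by (intro borel_measurable_continuous_onI continuous_on_compose2[OF J] continuous_intros) auto
    then show ?thesis by (simp add: measurable_completion)
  qed
  have wm: "w \<in> borel_measurable lebesgue" using w by auto
  have ki: "integrable lebesgue (\<lambda>y. k * \<bar>w y\<bar>)" using w by simp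
  have le: "norm (J (x - y) * w y) \<le> k * \<bar>w y\<bar>" for x y
    using Jk[of "x - y"] by (simp add: abs_mult mult_right_mono)
  show i: "integrable lebesgue (\<lambda>y. J (x - y) * w y)" for x
    by (rule Bochner_Integration.integrable_bound[OF ki])
      (use Jm wm order_trans[OF le abs_ge_self] in \<open>auto intro!: AE_I2\<close>)
  show "\<bar>LINT y|lebesgue. J (x - y) * w y\<bar> \<le> k * (LINT y|lebesgue. \<bar>w y\<bar>)"
  proof -
    have "\<bar>LINT y|lebesgue. J (x - y) * w y\<bar> \<le> (LINT y|lebesgue. \<bar>J (x - y) * w y\<bar>)"
      using integral_norm_bound[of lebesgue "\<lambda>y. J (x - y) * w y"] by simp
    also have "\<dots> \<le> (LINT y|lebesgue. k * \<bar>w y\<bar>)"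
      using i[of x] ki le by (intro integral_mono) auto
    finally show ?thesis by simp
  qed
  show "continuous_on UNIV (\<lambda>x. LINT y|lebesgue. J (x - y) * w y)"
    unfolding continuous_on_sequentially
  proof (intro allI ballI impI, elim conjE)
    fix x and xs :: "nat \<Rightarrow> 'a" assume xs: "xs \<longlonglongrightarrow> x"
    have "(\<lambda>i. LINT y|lebesgue. J (xs i - y) * w y) \<longlonglongrightarrow> (LINT y|lebesgue. J (x - y) * w y)"
    proof (rule integral_dominated_convergence[OF _ _ ki])
      show "AE y in lebesgue. (\<lambda>i. J (xs i - y) * w y) \<longlonglongrightarrow> J (x - y) * w y"
        by (intro AE_I2 tendsto_mult tendsto_const continuous_on_tendsto_compose[OF J] tendsto_diff xs) auto
    qed (use Jm wm le in auto)
    then show "((\<lambda>x. LINT y|lebesgue. J (x - y) * w y) \<circ> xs) \<longlonglongrightarrow> (LINT y|lebesgue. J (x - y) * w y)"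
      by (simp add: o_def)
  qed
qed

section \<open>The covering argument\<close>

text \<open>Joint measurability in the centre of the ball and the variable of integration, as required for
  measurability of integrals in the centre and for exchanging integrals.\<close>

lemma near_measurable:
  assumes [measurable]: "S \<in> sets borel"
  shows "(\<lambda>(x :: 'a::euclidean_space, y). indicat_real (S \<inter> ball x \<delta>) y)
    \<in> borel_measurable (lborel \<Otimes>\<^sub>M lborel)"
proof -
  have "open {p :: 'a \<times> 'a. dist (fst p) (snd p) < \<delta>}"
    by (intro open_Collect_less continuous_intros)
  then have 1: "{p :: 'a \<times> 'a. dist (fst p) (snd p) < \<delta>} \<in> sets (lborel \<Otimes>\<^sub>M lborel)"
    unfolding lborel_prod by simp
  have 2: "snd -` S \<inter> space (lborel \<Otimes>\<^sub>M lborel) \<in> sets (lborel \<Otimes>\<^sub>M (lborel :: 'a measure))"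
    by (rule measurable_sets[OF measurable_snd]) simp
  have eq: "(\<lambda>(x :: 'a, y). indicat_real (S \<inter> ball x \<delta>) y) =
    indicat_real ((snd -` S \<inter> space (lborel \<Otimes>\<^sub>M lborel)) \<inter> {p. dist (fst p) (snd p) < \<delta>})"
    by (auto simp: fun_eq_iff indicator_def space_pair_measure)
  show ?thesis unfolding eq using sets.Int[OF 2 1] by (rule borel_measurable_indicator)
qed

lemma measure_open_pos:
  fixes S :: "'a::euclidean_space set"
  assumes "open S" "bounded S" "x \<in> S"
  shows "0 < measure lborel S"
proof -
  obtain r where r: "r > 0" "ball x r \<subseteq> S" using assms by (meson open_contains_ball)
  have "0 < measure lborel (ball x r)" using content_ball_pos[OF r(1)] by simp
  also have "\<dots> \<le> measure lborel S"
    using r(2) assms(1) emeasure_bounded_finite[OF assms(2)]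
    by (intro measure_mono_fmeasurable fmeasurableI) auto
  finally show ?thesis .
qed

text \<open>The uniform bound behind the local means: cover \<open>ball y \<delta>\<close> by a number of balls of radius
  \<open>\<delta> / 2\<close> that depends on the dimension only. If \<open>x\<close> lies in \<open>\<Omega>\<close> and in one of them, say \<open>B\<close>, then
  \<open>B \<subseteq> ball x \<delta>\<close>, so $|\Omega\cap B_\delta(x)| \ge |\Omega\cap B|$, and the integral over
  $\Omega\cap B$ is at most \<open>1\<close>. No regularity of the boundary of \<open>\<Omega>\<close> is needed.\<close>

lemma covering_bound:
  "\<exists>n>0. \<forall>(S::'a::euclidean_space set) \<delta> y. open S \<longrightarrow> bounded S \<longrightarrow> \<delta> > 0 \<longrightarrow>
     (\<integral>\<^sup>+x. ennreal (indicator (S \<inter> ball y \<delta>) x * (1 / measure lborel (S \<inter> ball x \<delta>))) \<partial>lborel)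
       \<le> ennreal n"
proof -
  have "compact (cball (0::'a) 1)" by simp
  moreover have "cball (0::'a) 1 \<subseteq> \<Union> ((\<lambda>k. ball k (1/2)) ` UNIV)"
    using centre_in_ball[of _ "1/2 :: real"] by fastforce
  moreover have "\<And>B. B \<in> (\<lambda>k. ball k (1/2)) ` (UNIV :: 'a set) \<Longrightarrow> open B" by auto
  ultimately obtain D where D: "D \<subseteq> (\<lambda>k. ball k (1/2)) ` (UNIV :: 'a set)" "finite D" "cball 0 1 \<subseteq> \<Union>D"
    by (rule compactE)
  obtain K :: "'a set" where K: "finite K" "D = (\<lambda>k. ball k (1/2)) ` K"
    using finite_subset_image[OF D(2,1)] by auto
  have "K \<noteq> {}" using D(3) K(2) by auto
  then have cardK: "0 < real (card K)" using K(1) by (simp add: card_gt_0_iff)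
  have "(\<integral>\<^sup>+x. ennreal (indicator (S \<inter> ball y \<delta>) x * (1 / measure lborel (S \<inter> ball x \<delta>))) \<partial>lborel)
       \<le> ennreal (real (card K))"
    if S: "open S" "bounded S" and \<delta>: "\<delta> > 0" for S :: "'a set" and \<delta> y
  proof -
    define B where "B k = S \<inter> ball (y + \<delta> *\<^sub>R k) (\<delta> / 2)" for k
    define v where "v k = measure lborel (B k)" for k
    have Bfin: "A \<subseteq> S \<Longrightarrow> emeasure lborel A < \<infinity>" for A
      by (rule emeasure_bounded_finite) (rule bounded_subset[OF S(2)])
    have Bm [measurable]: "B k \<in> sets borel" for k using S by (simp add: B_def open_Int)
    have ptw: "ennreal (indicator (S \<inter> ball y \<delta>) x * (1 / measure lborel (S \<inter> ball x \<delta>)))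
        \<le> (\<Sum>k\<in>K. ennreal (1 / v k) * indicator (B k) x)" for x
    proof (cases "x \<in> S \<inter> ball y \<delta>")
      case True
      then have "norm (x - y) / \<delta> \<le> 1" using \<delta> by (simp add: dist_norm norm_minus_commute)
      moreover have "norm ((x - y) /\<^sub>R \<delta>) = norm (x - y) / \<delta>"
        using \<delta> unfolding norm_scaleR by (simp add: divide_inverse mult.commute)
      ultimately have "norm ((x - y) /\<^sub>R \<delta>) \<le> 1" by simp
      then have "(x - y) /\<^sub>R \<delta> \<in> cball 0 1" by simp
      then obtain k where k: "k \<in> K" "(x - y) /\<^sub>R \<delta> \<in> ball k (1/2)"
        using D(3) K(2) by blast
      have "x - (y + \<delta> *\<^sub>R k) = \<delta> *\<^sub>R ((x - y) /\<^sub>R \<delta> - k)"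
        using \<delta> by (simp add: algebra_simps)
      then have "norm (x - (y + \<delta> *\<^sub>R k)) = \<delta> * norm ((x - y) /\<^sub>R \<delta> - k)"
        using \<delta> by simp
      also have "\<dots> < \<delta> * (1/2)"
        using k(2) \<delta> by (intro mult_strict_left_mono) (auto simp: dist_norm norm_minus_commute)
      finally have xk: "dist (y + \<delta> *\<^sub>R k) x < \<delta> / 2" by (simp add: dist_norm norm_minus_commute)
      have sub: "B k \<subseteq> S \<inter> ball x \<delta>"
      proof
        fix z assume z: "z \<in> B k"
        then have "dist (y + \<delta> *\<^sub>R k) z < \<delta> / 2" by (auto simp: B_def)
        then have "dist x z < \<delta>"
          using xk dist_triangle3[of x z "y + \<delta> *\<^sub>R k"] by simp
        with z show "z \<in> S \<inter> ball x \<delta>" by (auto simp: B_def)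
      qed
      have xB: "x \<in> B k" using True xk by (auto simp: B_def)
      have "0 < v k"
        unfolding v_def
        by (rule measure_open_pos[OF _ _ xB]) (use S in \<open>auto simp: B_def intro: bounded_subset[OF S(2)]\<close>)
      moreover have "v k \<le> measure lborel (S \<inter> ball x \<delta>)"
        unfolding v_def using sub S Bfin[of "S \<inter> ball x \<delta>"]
        by (intro measure_mono_fmeasurable fmeasurableI) (auto simp: B_def)
      ultimately have "ennreal (indicator (S \<inter> ball y \<delta>) x * (1 / measure lborel (S \<inter> ball x \<delta>)))
          \<le> ennreal (1 / v k) * indicator (B k) x"
        using True xB by (auto intro!: ennreal_leI divide_left_mono)
      also have "\<dots> \<le> (\<Sum>k\<in>K. ennreal (1 / v k) * indicator (B k) x)"
        using k(1) K(1) by (intro member_le_sum) auto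
      finally show ?thesis .
    qed auto
    have "(\<integral>\<^sup>+x. ennreal (indicator (S \<inter> ball y \<delta>) x * (1 / measure lborel (S \<inter> ball x \<delta>))) \<partial>lborel)
        \<le> (\<integral>\<^sup>+x. (\<Sum>k\<in>K. ennreal (1 / v k) * indicator (B k) x) \<partial>lborel)"
      by (intro nn_integral_mono ptw)
    also have "\<dots> = (\<Sum>k\<in>K. \<integral>\<^sup>+x. ennreal (1 / v k) * indicator (B k) x \<partial>lborel)"
      by (intro nn_integral_sum) measurable
    also have "\<dots> = (\<Sum>k\<in>K. ennreal (1 / v k) * emeasure lborel (B k))"
      by (intro sum.cong refl nn_integral_cmult_indicator) simp
    also have "\<dots> \<le> (\<Sum>k\<in>K. 1)"
    proof (rule sum_mono)
      fix k
      have "emeasure lborel (B k) = ennreal (v k)"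
        unfolding v_def using Bfin[of "B k"] by (intro emeasure_eq_ennreal_measure) (auto simp: B_def)
      then have "ennreal (1 / v k) * emeasure lborel (B k) = ennreal (1 / v k * v k)"
        by (simp add: ennreal_mult[symmetric] v_def)
      also have "\<dots> \<le> ennreal 1" by (intro ennreal_leI) auto
      finally show "ennreal (1 / v k) * emeasure lborel (B k) \<le> 1" by simp
    qed
    also have "\<dots> = ennreal (real (card K))" by (simp add: ennreal_of_nat_eq_real_of_nat)
    finally show ?thesis .
  qed
  then show ?thesis using cardK by blast
qed

section \<open>Local means\<close>

text \<open>A measurable weight on a bounded open set, with values between \<open>c > 0\<close> and \<open>1\<close> there and zero
  outside.\<close>

locale positive_density =
  fixes \<Omega> :: "'a::euclidean_space set" and X :: "'a \<Rightarrow> real" and c :: real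
  assumes open_\<Omega>: "open \<Omega>" and bounded_\<Omega>: "bounded \<Omega>"
    and X_measurable: "X \<in> borel_measurable lebesgue"
    and X_outside: "\<And>x. x \<notin> \<Omega> \<Longrightarrow> X x = 0"
    and X_ge: "\<And>x. x \<in> \<Omega> \<Longrightarrow> c \<le> X x" and X_le: "\<And>x. X x \<le> 1" and c_pos: "0 < c"
begin

lemma \<Omega>_lmeasurable: "\<Omega> \<in> lmeasurable"
  using open_\<Omega> bounded_\<Omega> by (simp add: lmeasurable_open)

lemma X_abs: "\<bar>X x\<bar> \<le> 1"
  using X_outside[of x] X_ge[of x] X_le[of x] c_pos by (cases "x \<in> \<Omega>") auto

lemma X_integrable: "integrable lebesgue X"
  using integrable_bounded_support[OF X_measurable \<Omega>_lmeasurable X_outside X_abs] .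

lemma set_integrable_ball:
  fixes w :: "'a \<Rightarrow> real"
  assumes "integrable lebesgue w"
  shows "set_integrable lebesgue (ball x \<delta>) w"
  using assms unfolding set_integrable_def by (intro integrable_mult_indicator) auto

lemma local_mass_ge: "c * measure lborel (\<Omega> \<inter> ball x \<delta>) \<le> (LINT y:ball x \<delta>|lebesgue. X y)"
proof -
  have fin: "emeasure lborel (\<Omega> \<inter> ball x \<delta>) < \<infinity>"
    by (rule emeasure_bounded_finite) (rule bounded_subset[OF bounded_\<Omega>], auto)
  have "c * measure lborel (\<Omega> \<inter> ball x \<delta>) = (LINT y|lebesgue. c * indicat_real (\<Omega> \<inter> ball x \<delta>) y)"
    using open_\<Omega> by (simp add: measure_completion)
  also have "\<dots> \<le> (LINT y|lebesgue. indicat_real (ball x \<delta>) y *\<^sub>R X y)"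
  proof (rule integral_mono)
    show "integrable lebesgue (\<lambda>y. c * indicat_real (\<Omega> \<inter> ball x \<delta>) y)"
      using open_\<Omega> fin by (intro integrable_mult_right integrable_real_indicator) auto
    show "integrable lebesgue (\<lambda>y. indicat_real (ball x \<delta>) y *\<^sub>R X y)"
      using set_integrable_ball[OF X_integrable] by (simp add: set_integrable_def)
    show "c * indicat_real (\<Omega> \<inter> ball x \<delta>) y \<le> indicat_real (ball x \<delta>) y *\<^sub>R X y" for y
      using X_ge[of y] X_outside[of y] by (auto simp: indicator_def)
  qed
  finally show ?thesis by (simp add: set_lebesgue_integral_def)
qed

lemma local_volume_pos: "x \<in> \<Omega> \<Longrightarrow> \<delta> > 0 \<Longrightarrow> 0 < measure lborel (\<Omega> \<inter> ball x \<delta>)"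
  by (rule measure_open_pos[of _ x]) (use open_\<Omega> bounded_\<Omega> in auto)

lemma local_mass_pos:
  assumes "x \<in> \<Omega>" "\<delta> > 0"
  shows "0 < (LINT y:ball x \<delta>|lebesgue. X y)"
  using local_mass_ge[of x \<delta>] mult_pos_pos[OF c_pos local_volume_pos[OF assms]] by linarith

lemma local_mean_diff:
  assumes "integrable lebesgue w" "integrable lebesgue w'"
  shows "local_mean X \<delta> x (\<lambda>y. w y - w' y) = local_mean X \<delta> x w - local_mean X \<delta> x w'"
  using set_integrable_ball[OF assms(1)] set_integrable_ball[OF assms(2)]
  by (simp add: local_mean_def right_diff_distrib set_integral_diff(2))

text \<open>At points of \<open>\<Omega>\<close> and in the supremum norm the local means are bounded by \<open>1 / c\<close>, since the weight in the
  denominator is at least \<open>c\<close> on the part of the ball that carries \<open>w\<close>.\<close>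

lemma local_mean_bounded:
  assumes w: "integrable lebesgue w" and w0: "\<And>y. y \<notin> \<Omega> \<Longrightarrow> w y = 0" and wk: "\<And>y. \<bar>w y\<bar> \<le> k"
    and x: "x \<in> \<Omega>" and \<delta>: "\<delta> > 0"
  shows "\<bar>local_mean X \<delta> x w\<bar> \<le> k / c"
proof -
  let ?m = "LINT y:ball x \<delta>|lebesgue. X y"
  have m: "0 < ?m" by (rule local_mass_pos[OF x \<delta>])
  have k: "k \<ge> 0" using wk[of x] by linarith
  have "\<bar>LINT y:ball x \<delta>|lebesgue. w y\<bar> \<le> (LINT y|lebesgue. \<bar>indicat_real (ball x \<delta>) y *\<^sub>R w y\<bar>)"
    unfolding set_lebesgue_integral_def
    using integral_norm_bound[of lebesgue "\<lambda>y. indicat_real (ball x \<delta>) y *\<^sub>R w y"] by simp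
  also have "\<dots> \<le> (LINT y|lebesgue. k / c * (indicat_real (ball x \<delta>) y *\<^sub>R X y))"
  proof (rule integral_mono)
    show "integrable lebesgue (\<lambda>y. \<bar>indicat_real (ball x \<delta>) y *\<^sub>R w y\<bar>)"
      using set_integrable_ball[OF w, of x \<delta>] by (simp only: set_integrable_def integrable_abs)
    show "integrable lebesgue (\<lambda>y. k / c * (indicat_real (ball x \<delta>) y *\<^sub>R X y))"
      using set_integrable_ball[OF X_integrable, of x \<delta>]
      by (intro integrable_mult_right) (simp only: set_integrable_def)
    fix y
    show "\<bar>indicat_real (ball x \<delta>) y *\<^sub>R w y\<bar> \<le> k / c * (indicat_real (ball x \<delta>) y *\<^sub>R X y)"
    proof (cases "y \<in> \<Omega> \<and> y \<in> ball x \<delta>")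
      case True
      have "\<bar>w y\<bar> \<le> k / c * c" using wk[of y] c_pos by simp
      also have "\<dots> \<le> k / c * X y" using True X_ge[of y] k c_pos by (intro mult_left_mono) auto
      finally show ?thesis using True by simp
    next
      case False
      then show ?thesis using w0[of y] X_outside[of y] by (auto simp: indicator_def)
    qed
  qed
  also have "\<dots> = k / c * ?m" by (simp add: set_lebesgue_integral_def)
  finally have "\<bar>LINT y:ball x \<delta>|lebesgue. w y\<bar> / ?m \<le> k / c"
    using m by (simp add: pos_divide_le_eq)
  then show ?thesis using m by (simp add: local_mean_def abs_mult)
qed

text \<open>Measurability in a parameter holds for integrands on a product of Borel spaces, so \<open>w\<close> is
  replaced by a Borel function that is equal to it almost everywhere.\<close>

lemma local_integral_measurable:
  fixes w :: "'a \<Rightarrow> real"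
  assumes "w \<in> borel_measurable lebesgue"
  shows "(\<lambda>x. LINT y:ball x \<delta>|lebesgue. w y) \<in> borel_measurable lebesgue"
proof -
  obtain w' where w': "w' \<in> borel_measurable lborel" "AE x in lborel. w x = w' x"
    using completion_ex_borel_measurable_real[OF assms] by blast
  have eq: "(LINT y:ball x \<delta>|lebesgue. w y) = (LINT y|lborel. indicat_real (UNIV \<inter> ball x \<delta>) y * w' y)" for x
  proof -
    have "(LINT y:ball x \<delta>|lebesgue. w y) = (LINT y|lebesgue. indicat_real (UNIV \<inter> ball x \<delta>) y * w' y)"
      unfolding set_lebesgue_integral_def
    proof (rule integral_cong_AE)
      show "AE y in lebesgue. indicat_real (ball x \<delta>) y *\<^sub>R w y = indicat_real (UNIV \<inter> ball x \<delta>) y * w' y"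
        using AE_completion[OF w'(2)] by eventually_elim simp
      show "(\<lambda>y. indicat_real (ball x \<delta>) y *\<^sub>R w y) \<in> borel_measurable lebesgue"
        using assms by (intro borel_measurable_scaleR borel_measurable_indicator) auto
      show "(\<lambda>y. indicat_real (UNIV \<inter> ball x \<delta>) y * w' y) \<in> borel_measurable lebesgue"
        using measurable_completion[OF w'(1)]
        by (intro borel_measurable_times borel_measurable_indicator) auto
    qed
    also have "\<dots> = (LINT y|lborel. indicat_real (UNIV \<inter> ball x \<delta>) y * w' y)"
      using w'(1) by (intro integral_completion borel_measurable_times borel_measurable_indicator) auto
    finally show ?thesis .
  qed
  have "(\<lambda>(x, y). indicat_real (UNIV \<inter> ball x \<delta>) y * w' y) \<in> borel_measurable (lborel \<Otimes>\<^sub>M lborel)"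
  proof -
    have "(\<lambda>p :: 'a \<times> 'a. w' (snd p)) \<in> borel_measurable (lborel \<Otimes>\<^sub>M lborel)"
      using w'(1) by (intro measurable_compose[OF measurable_snd])
    then have "(\<lambda>p. (case p of (x, y) \<Rightarrow> indicat_real (UNIV \<inter> ball x \<delta>) y) * w' (snd p))
        \<in> borel_measurable (lborel \<Otimes>\<^sub>M lborel)"
      by (intro borel_measurable_times near_measurable) auto
    then show ?thesis by (simp add: case_prod_beta)
  qed
  then have "(\<lambda>x. LINT y|lborel. indicat_real (UNIV \<inter> ball x \<delta>) y * w' y) \<in> borel_measurable lborel"
    by (rule lborel.borel_measurable_lebesgue_integral)
  then show ?thesis unfolding eq by (rule measurable_completion)
qed

lemma local_mean_measurable:
  assumes "w \<in> borel_measurable lebesgue"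
  shows "(\<lambda>x. local_mean X \<delta> x w) \<in> borel_measurable lebesgue"
  unfolding local_mean_def
  using local_integral_measurable[OF assms, of \<delta>] local_integral_measurable[OF X_measurable, of \<delta>]
  by (intro borel_measurable_times borel_measurable_divide) auto

text \<open>Averages over small balls converge at a point of continuity.\<close>

lemma ball_average_tendsto:
  fixes f :: "'a \<Rightarrow> real"
  assumes f: "integrable lebesgue f" and cont: "isCont f x"
  shows "((\<lambda>\<delta>. (LINT y:ball x \<delta>|lebesgue. f y) / measure lebesgue (ball x \<delta>)) \<longlongrightarrow> f x) (at_right 0)"
proof (rule tendstoI)
  fix e :: real assume e: "e > 0"
  then obtain d where d: "d > 0" "\<And>y. dist y x < d \<Longrightarrow> dist (f y) (f x) < e / 2"
    using cont unfolding continuous_at_eps_delta by (metis half_gt_zero)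
  show "\<forall>\<^sub>F \<delta> in at_right 0.
      dist ((LINT y:ball x \<delta>|lebesgue. f y) / measure lebesgue (ball x \<delta>)) (f x) < e"
  proof (rule eventually_at_rightI[OF _ d(1)])
    fix \<delta> assume \<delta>: "\<delta> \<in> {0<..<d}"
    let ?m = "measure lebesgue (ball x \<delta>)"
    have m: "0 < ?m" using \<delta> content_ball_pos[of \<delta> x] by (simp add: measure_completion)
    have bi: "set_integrable lebesgue (ball x \<delta>) (\<lambda>y. k :: real)" for k
      unfolding set_integrable_def
      using emeasure_bounded_finite[OF bounded_ball, of x \<delta>]
      by (intro integrable_scaleR_left integrable_real_indicator) auto
    have bk: "(LINT y:ball x \<delta>|lebesgue. k) = ?m * k" for k :: real
      by (simp add: set_lebesgue_integral_def measure_completion)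
    have "(LINT y:ball x \<delta>|lebesgue. f y) - ?m * f x = (LINT y:ball x \<delta>|lebesgue. f y - f x)"
      using set_integral_diff(2)[OF set_integrable_ball[OF f] bi] by (simp add: bk)
    also have "\<bar>\<dots>\<bar> \<le> (LINT y:ball x \<delta>|lebesgue. \<bar>f y - f x\<bar>)"
      unfolding set_lebesgue_integral_def
      using integral_norm_bound[of lebesgue "\<lambda>y. indicat_real (ball x \<delta>) y *\<^sub>R (f y - f x)"]
      by (simp add: abs_mult)
    also have "\<dots> \<le> (LINT y:ball x \<delta>|lebesgue. e / 2)"
    proof (rule set_integral_mono)
      show "set_integrable lebesgue (ball x \<delta>) (\<lambda>y. \<bar>f y - f x\<bar>)"
        by (intro set_integrable_abs set_integral_diff(1) set_integrable_ball f bi)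
      show "\<bar>f y - f x\<bar> \<le> e / 2" if "y \<in> ball x \<delta>" for y
        using d(2)[of y] that \<delta> by (simp add: dist_real_def dist_commute)
    qed (rule bi)
    also have "\<dots> = ?m * (e / 2)" by (rule bk)
    finally have "\<bar>((LINT y:ball x \<delta>|lebesgue. f y) - ?m * f x) / ?m\<bar> \<le> e / 2"
      using m by (simp add: pos_divide_le_eq mult.commute)
    moreover have "((LINT y:ball x \<delta>|lebesgue. f y) - ?m * f x) / ?m =
        (LINT y:ball x \<delta>|lebesgue. f y) / ?m - f x"
      using m by (simp add: diff_divide_distrib)
    ultimately have "\<bar>(LINT y:ball x \<delta>|lebesgue. f y) / ?m - f x\<bar> \<le> e / 2" by (simp only:)
    then show "dist ((LINT y:ball x \<delta>|lebesgue. f y) / ?m) (f x) < e"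
      using e unfolding dist_real_def by linarith
  qed
qed

lemma local_mean_tendsto:
  assumes w: "integrable lebesgue w" and cont: "isCont w x" "isCont X x" and x: "x \<in> \<Omega>"
  shows "((\<lambda>\<delta>. local_mean X \<delta> x w) \<longlongrightarrow> 1 / X x * w x) (at_right 0)"
proof -
  have "X x \<noteq> 0" using X_ge[OF x] c_pos by auto
  then have "((\<lambda>\<delta>. ((LINT y:ball x \<delta>|lebesgue. w y) / measure lebesgue (ball x \<delta>)) /
      ((LINT y:ball x \<delta>|lebesgue. X y) / measure lebesgue (ball x \<delta>))) \<longlongrightarrow> w x / X x) (at_right 0)"
    by (intro tendsto_divide ball_average_tendsto w X_integrable cont)
  moreover have "\<forall>\<^sub>F \<delta> in at_right 0. ((LINT y:ball x \<delta>|lebesgue. w y) / measure lebesgue (ball x \<delta>)) /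
      ((LINT y:ball x \<delta>|lebesgue. X y) / measure lebesgue (ball x \<delta>)) = local_mean X \<delta> x w"
  proof (rule eventually_at_rightI[of 0 1])
    fix \<delta> :: real assume "\<delta> \<in> {0<..<1}"
    then have "0 < measure lebesgue (ball x \<delta>)"
      using content_ball_pos[of \<delta> x] by (simp add: measure_completion)
    then show "((LINT y:ball x \<delta>|lebesgue. w y) / measure lebesgue (ball x \<delta>)) /
      ((LINT y:ball x \<delta>|lebesgue. X y) / measure lebesgue (ball x \<delta>)) = local_mean X \<delta> x w"
      by (simp add: local_mean_def)
  qed simp
  ultimately have "((\<lambda>\<delta>. local_mean X \<delta> x w) \<longlongrightarrow> w x / X x) (at_right 0)"
    by (rule Lim_transform_eventually)
  then show ?thesis by simp
qed

text \<open>The local means are bounded on $L^2(\Omega)$ by a constant that depends on \<open>c\<close> and on the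
  bound \<open>n\<close> from the covering argument only. With $V(x)=|\Omega\cap B_\delta(x)|$, Cauchy-Schwarz gives
  $|M w(x)|^2\le \frac{1}{c^2 V(x)}\int_{B_\delta(x)} w^2$; then the order of integration is
  exchanged and the covering bound is applied to the inner integral.\<close>

lemma local_mean_L2:
  assumes w: "w \<in> L2_space \<Omega>" and w0: "\<And>y. y \<notin> \<Omega> \<Longrightarrow> w y = 0" and \<delta>: "\<delta> > 0" and n: "n \<ge> 0"
    and cov: "\<And>y. (\<integral>\<^sup>+x. ennreal (indicator (\<Omega> \<inter> ball y \<delta>) x *
        (1 / measure lborel (\<Omega> \<inter> ball x \<delta>))) \<partial>lborel) \<le> ennreal n"
  shows "(\<lambda>x. local_mean X \<delta> x w) \<in> L2_space \<Omega>"
    and "L2_norm \<Omega> (\<lambda>x. local_mean X \<delta> x w) \<le> sqrt n / c * L2_norm \<Omega> w"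
proof -
  note ext = L2_zero_extension[OF \<Omega>_lmeasurable w w0]
  define V where "V x = measure lborel (\<Omega> \<inter> ball x \<delta>)" for x
  have V: "0 < V x" if "x \<in> \<Omega>" for x using local_volume_pos[OF that \<delta>] by (simp add: V_def)
  obtain w' where w': "w' \<in> borel_measurable lborel" "AE x in lborel. w x = w' x"
    using completion_ex_borel_measurable_real[OF ext(1)] by blast
  have near: "(\<lambda>(x, y). indicat_real (\<Omega> \<inter> ball x \<delta>) y) \<in> borel_measurable (lborel \<Otimes>\<^sub>M lborel)"
    using open_\<Omega> by (intro near_measurable) auto
  have Vm: "V \<in> borel_measurable lborel"
  proof -
    have "V = (\<lambda>x. LINT y|lborel. indicat_real (\<Omega> \<inter> ball x \<delta>) y)"
      using open_\<Omega> by (auto simp: V_def)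
    then show ?thesis using lborel.borel_measurable_lebesgue_integral[OF near] by simp
  qed
  define H where "H x y = ennreal (indicat_real \<Omega> x * indicat_real (\<Omega> \<inter> ball x \<delta>) y * (1 / V x) * (w' y)\<^sup>2)"
    for x y
  have Hm: "case_prod H \<in> borel_measurable (lborel \<Otimes>\<^sub>M lborel)"
  proof -
    have "(\<lambda>p :: 'a \<times> 'a. w' (snd p)) \<in> borel_measurable (lborel \<Otimes>\<^sub>M lborel)"
      using w'(1) by (intro measurable_compose[OF measurable_snd])
    moreover have "(\<lambda>p :: 'a \<times> 'a. V (fst p)) \<in> borel_measurable (lborel \<Otimes>\<^sub>M lborel)"
      using Vm by (intro measurable_compose[OF measurable_fst])
    moreover have "(\<lambda>p :: 'a \<times> 'a. indicat_real \<Omega> (fst p)) \<in> borel_measurable (lborel \<Otimes>\<^sub>M lborel)"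
      using open_\<Omega> by (intro measurable_compose[OF measurable_fst] borel_measurable_indicator) auto
    ultimately have "(\<lambda>p. ennreal (indicat_real \<Omega> (fst p) * (case p of (x, y) \<Rightarrow> indicat_real (\<Omega> \<inter> ball x \<delta>) y) *
        (1 / V (fst p)) * (w' (snd p))\<^sup>2)) \<in> borel_measurable (lborel \<Otimes>\<^sub>M lborel)"
      using near by (intro measurable_compose[OF _ measurable_ennreal] borel_measurable_times
          borel_measurable_divide borel_measurable_power borel_measurable_const)
    then show ?thesis by (simp add: case_prod_beta H_def[abs_def])
  qed
  \<comment> \<open>Cauchy-Schwarz on $\Omega\cap B_\delta(x)$.\<close>
  have ptw: "ennreal ((local_mean X \<delta> x w)\<^sup>2) * indicator \<Omega> x \<le> ennreal (1 / c\<^sup>2) * (\<integral>\<^sup>+y. H x y \<partial>lborel)"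
    for x
  proof (cases "x \<in> \<Omega>")
    case x: True
    let ?S = "\<Omega> \<inter> ball x \<delta>" and ?m = "LINT y:ball x \<delta>|lebesgue. X y"
    have S: "?S \<in> sets lebesgue" using open_\<Omega> by auto
    have SL: "?S \<in> lmeasurable" using open_\<Omega> bounded_\<Omega> by (intro lmeasurable_open) (auto intro: bounded_subset)
    have ind: "indicat_real ?S y * w y = indicat_real (ball x \<delta>) y * w y" for y
      using w0[of y] by (auto simp: indicator_def)
    have i2: "integrable lebesgue (\<lambda>y. indicat_real ?S y * (w y)\<^sup>2)"
      using integrable_mult_indicator[OF S ext(2)] by simp
    have wS: "w \<in> L2_space ?S"
      using measurable_restrict_space1[OF ext(1)] i2 S
      by (simp add: L2_space_def integrable_restrict_space)
    have "\<bar>LINT y|lebesgue_on ?S. w y * 1\<bar> \<le> L2_norm ?S w * (1 * sqrt (measure lebesgue ?S))"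
    proof (rule order_trans[OF L2_Cauchy_Schwarz[OF wS L2_bounded(1)[OF _ SL]]])
      show "L2_norm ?S w * L2_norm ?S (\<lambda>x. 1) \<le> L2_norm ?S w * (1 * sqrt (measure lebesgue ?S))"
        by (intro mult_left_mono L2_bounded(2) SL) auto
    qed (auto intro: order_refl[of "1::real"])
    moreover have "(LINT y|lebesgue_on ?S. w y * 1) = (LINT y:ball x \<delta>|lebesgue. w y)"
      using S by (simp add: integral_restrict_space ind set_lebesgue_integral_def)
    moreover have "measure lebesgue ?S = V x"
      using open_\<Omega> by (simp add: V_def measure_completion)
    ultimately have "\<bar>LINT y:ball x \<delta>|lebesgue. w y\<bar> \<le> L2_norm ?S w * sqrt (V x)" by simp
    then have "\<bar>LINT y:ball x \<delta>|lebesgue. w y\<bar>\<^sup>2 \<le> (L2_norm ?S w * sqrt (V x))\<^sup>2"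
      by (intro power_mono) auto
    then have CS: "(LINT y:ball x \<delta>|lebesgue. w y)\<^sup>2 \<le> (L2_norm ?S w)\<^sup>2 * V x"
      using V[OF x] by (simp add: power_mult_distrib)
    have m: "c * V x \<le> ?m" using local_mass_ge by (simp add: V_def)
    have cV: "0 < c * V x" using V[OF x] c_pos by simp
    have "(local_mean X \<delta> x w)\<^sup>2 = (LINT y:ball x \<delta>|lebesgue. w y)\<^sup>2 / ?m\<^sup>2"
      by (simp add: local_mean_def power_divide)
    also have "\<dots> \<le> ((L2_norm ?S w)\<^sup>2 * V x) / (c * V x)\<^sup>2"
      using CS m cV V[OF x] by (intro frac_le power_mono) auto
    also have "\<dots> = 1 / c\<^sup>2 * (1 / V x * (L2_norm ?S w)\<^sup>2)"
      using V[OF x] c_pos by (simp add: power2_eq_square field_simps)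
    finally have "ennreal ((local_mean X \<delta> x w)\<^sup>2) \<le> ennreal (1 / c\<^sup>2 * (1 / V x * (L2_norm ?S w)\<^sup>2))"
      by (rule ennreal_leI)
    also have "\<dots> = ennreal (1 / c\<^sup>2) * ennreal (1 / V x * (L2_norm ?S w)\<^sup>2)"
      by (rule ennreal_mult) (use V[OF x] in auto)
    also have "ennreal (1 / V x * (L2_norm ?S w)\<^sup>2) = (\<integral>\<^sup>+y. H x y \<partial>lborel)"
    proof -
      have "1 / V x * (L2_norm ?S w)\<^sup>2 = (LINT y|lebesgue. 1 / V x * (indicat_real ?S y * (w y)\<^sup>2))"
        unfolding L2_norm_power2 using S by (simp add: integral_restrict_space)
      also have "ennreal \<dots> = (\<integral>\<^sup>+y. ennreal (1 / V x * (indicat_real ?S y * (w y)\<^sup>2)) \<partial>lebesgue)"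
        using V[OF x] by (intro nn_integral_eq_integral[symmetric] integrable_mult_right i2 AE_I2) auto
      also have "\<dots> = (\<integral>\<^sup>+y. ennreal (1 / V x * (indicat_real ?S y * (w y)\<^sup>2)) \<partial>lborel)"
        by (rule nn_integral_completion)
      also have "\<dots> = (\<integral>\<^sup>+y. H x y \<partial>lborel)"
      proof (rule nn_integral_cong_AE)
        show "AE y in lborel. ennreal (1 / V x * (indicat_real ?S y * (w y)\<^sup>2)) = H x y"
          using w'(2) by eventually_elim (use x in \<open>simp add: H_def mult_ac\<close>)
      qed
      finally show ?thesis .
    qed
    finally show ?thesis using x by simp
  qed simp
  \<comment> \<open>Tonelli, with the covering bound for the integral in \<open>x\<close>.\<close>
  have "(\<integral>\<^sup>+x. ennreal ((local_mean X \<delta> x w)\<^sup>2) * indicator \<Omega> x \<partial>lebesgue)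
      = (\<integral>\<^sup>+x. ennreal ((local_mean X \<delta> x w)\<^sup>2) * indicator \<Omega> x \<partial>lborel)"
    by (rule nn_integral_completion)
  also have "\<dots> \<le> (\<integral>\<^sup>+x. ennreal (1 / c\<^sup>2) * (\<integral>\<^sup>+y. H x y \<partial>lborel) \<partial>lborel)"
    by (intro nn_integral_mono ptw)
  also have "\<dots> = ennreal (1 / c\<^sup>2) * (\<integral>\<^sup>+x. (\<integral>\<^sup>+y. H x y \<partial>lborel) \<partial>lborel)"
    by (intro nn_integral_cmult lborel.borel_measurable_nn_integral Hm)
  also have "(\<integral>\<^sup>+x. (\<integral>\<^sup>+y. H x y \<partial>lborel) \<partial>lborel) = (\<integral>\<^sup>+y. (\<integral>\<^sup>+x. H x y \<partial>lborel) \<partial>lborel)"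
    by (rule lborel_pair.Fubini'[OF Hm, symmetric])
  also have "\<dots> \<le> (\<integral>\<^sup>+y. ennreal ((w' y)\<^sup>2) * ennreal n \<partial>lborel)"
  proof (rule nn_integral_mono)
    fix y
    let ?k = "\<lambda>x. ennreal (indicator (\<Omega> \<inter> ball y \<delta>) x * (1 / V x))"
    have km: "?k \<in> borel_measurable lborel"
      using Vm open_\<Omega> by (intro measurable_compose[OF _ measurable_ennreal] borel_measurable_times
          borel_measurable_divide borel_measurable_indicator borel_measurable_const) auto
    have "(\<integral>\<^sup>+x. H x y \<partial>lborel) \<le> (\<integral>\<^sup>+x. ennreal ((w' y)\<^sup>2) * ?k x \<partial>lborel)"
    proof (rule nn_integral_mono)
      fix x
      have "0 \<le> V x" by (simp add: V_def)
      then show "H x y \<le> ennreal ((w' y)\<^sup>2) * ?k x"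
        unfolding H_def by (subst ennreal_mult[symmetric])
          (auto simp: indicator_def dist_commute intro!: ennreal_leI)
    qed
    also have "\<dots> = ennreal ((w' y)\<^sup>2) * (\<integral>\<^sup>+x. ?k x \<partial>lborel)"
      by (rule nn_integral_cmult[OF km])
    also have "\<dots> \<le> ennreal ((w' y)\<^sup>2) * ennreal n"
      using cov[of y] by (intro mult_left_mono) (auto simp: V_def)
    finally show "(\<integral>\<^sup>+x. H x y \<partial>lborel) \<le> ennreal ((w' y)\<^sup>2) * ennreal n" .
  qed
  also have "\<dots> = (\<integral>\<^sup>+y. ennreal ((w' y)\<^sup>2) \<partial>lborel) * ennreal n"
    using w'(1) by (intro nn_integral_multc measurable_compose[OF _ measurable_ennreal]
        borel_measurable_power)
  also have "(\<integral>\<^sup>+y. ennreal ((w' y)\<^sup>2) \<partial>lborel) = (\<integral>\<^sup>+y. ennreal ((w y)\<^sup>2) \<partial>lborel)"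
  proof (rule nn_integral_cong_AE)
    show "AE y in lborel. ennreal ((w' y)\<^sup>2) = ennreal ((w y)\<^sup>2)"
      using w'(2) by eventually_elim simp
  qed
  also have "\<dots> = (\<integral>\<^sup>+y. ennreal ((w y)\<^sup>2) \<partial>lebesgue)"
    by (rule nn_integral_completion[symmetric])
  also have "\<dots> = ennreal ((L2_norm \<Omega> w)\<^sup>2)"
    using nn_integral_eq_integral[OF ext(2)] ext(3) by simp
  also have "ennreal (1 / c\<^sup>2) * (ennreal ((L2_norm \<Omega> w)\<^sup>2) * ennreal n) =
      ennreal ((sqrt n / c * L2_norm \<Omega> w)\<^sup>2)"
    using n by (simp add: ennreal_mult[symmetric] power_mult_distrib power_divide)
  finally have fin: "(\<integral>\<^sup>+x. ennreal ((local_mean X \<delta> x w)\<^sup>2) * indicator \<Omega> x \<partial>lebesgue)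
      \<le> ennreal ((sqrt n / c * L2_norm \<Omega> w)\<^sup>2)"
    by (simp add: mult_left_mono)
  have \<Omega>m: "\<Omega> \<inter> space lebesgue \<in> sets lebesgue" using open_\<Omega> by auto
  have fin': "(\<integral>\<^sup>+x. ennreal ((local_mean X \<delta> x w)\<^sup>2) \<partial>lebesgue_on \<Omega>)
      \<le> ennreal ((sqrt n / c * L2_norm \<Omega> w)\<^sup>2)"
    using fin by (simp add: nn_integral_restrict_space[OF \<Omega>m])
  have m: "(\<lambda>x. local_mean X \<delta> x w) \<in> borel_measurable (lebesgue_on \<Omega>)"
    by (intro measurable_restrict_space1 local_mean_measurable ext(1))
  have i: "integrable (lebesgue_on \<Omega>) (\<lambda>x. (local_mean X \<delta> x w)\<^sup>2)"
    using m le_less_trans[OF fin' ennreal_less_top] by (intro integrableI_bounded) auto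
  then show L: "(\<lambda>x. local_mean X \<delta> x w) \<in> L2_space \<Omega>" using m by (simp add: L2_space_def)
  have "ennreal ((L2_norm \<Omega> (\<lambda>x. local_mean X \<delta> x w))\<^sup>2) \<le> ennreal ((sqrt n / c * L2_norm \<Omega> w)\<^sup>2)"
    using fin' nn_integral_eq_integral[OF i] by (simp add: L2_norm_power2)
  then have "(L2_norm \<Omega> (\<lambda>x. local_mean X \<delta> x w))\<^sup>2 \<le> (sqrt n / c * L2_norm \<Omega> w)\<^sup>2"
    by (simp add: ennreal_le_iff)
  then show "L2_norm \<Omega> (\<lambda>x. local_mean X \<delta> x w) \<le> sqrt n / c * L2_norm \<Omega> w"
    using n c_pos by (intro power2_le_imp_le[of "L2_norm \<Omega> _"]) auto
qed

end

section \<open>The limit equation\<close>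

text \<open>The data of the evolution problem. The functions \<open>Jb\<close>, \<open>hb\<close>, \<open>ub\<close> and \<open>Xb\<close> are bounded and
  continuous on the whole space and agree with \<open>J\<close>, \<open>h\<close>, \<open>u\<^sub>0\<close> and \<open>X\<close> wherever the equation in \<open>\<Omega>\<close>
  evaluates them; for \<open>J\<close> these are the differences of points of \<open>\<Omega>\<close>. The bound \<open>c \<le> Xb\<close> is required
  everywhere, so that division by \<open>Xb\<close> preserves continuity.\<close>

locale nonlocal_problem = positive_density \<Omega> X c
  for \<Omega> :: "'a::euclidean_space set" and X c +
  fixes J h u\<^sub>0 :: "'a \<Rightarrow> real" and Jb hb ub Xb :: "'a \<Rightarrow>\<^sub>C real" and g :: "real \<Rightarrow> real" and L :: real
  assumes J_eq: "\<And>x y. x \<in> \<Omega> \<Longrightarrow> y \<in> \<Omega> \<Longrightarrow> J (x - y) = apply_bcontfun Jb (x - y)"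
    and h_eq: "\<And>x. x \<in> \<Omega> \<Longrightarrow> h x = apply_bcontfun hb x"
    and u\<^sub>0_eq: "\<And>x. x \<in> \<Omega> \<Longrightarrow> u\<^sub>0 x = apply_bcontfun ub x"
    and X_eq: "\<And>x. x \<in> \<Omega> \<Longrightarrow> X x = apply_bcontfun Xb x"
    and Xb_ge: "\<And>x. c \<le> apply_bcontfun Xb x"
    and g_lip: "\<And>s t. \<bar>g s - g t\<bar> \<le> L * \<bar>s - t\<bar>" and L_nonneg: "0 \<le> L"
begin

text \<open>The restriction of a bounded continuous function to \<open>\<Omega>\<close>, extended by zero.\<close>

definition cutoff :: "('a \<Rightarrow>\<^sub>C real) \<Rightarrow> 'a \<Rightarrow> real" where
  "cutoff z x = indicator \<Omega> x * apply_bcontfun z x"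

lemma bcontfun_measurable: "apply_bcontfun z \<in> borel_measurable lebesgue"
proof -
  have "apply_bcontfun z \<in> borel_measurable borel"
    by (intro borel_measurable_continuous_onI) simp
  then show ?thesis by (simp add: measurable_completion)
qed

lemma cutoff_measurable: "cutoff z \<in> borel_measurable lebesgue"
  unfolding cutoff_def[abs_def] using \<Omega>_lmeasurable bcontfun_measurable
  by (intro borel_measurable_times borel_measurable_indicator) auto

lemma cutoff_outside: "x \<notin> \<Omega> \<Longrightarrow> cutoff z x = 0"
  by (simp add: cutoff_def)

lemma cutoff_inside: "x \<in> \<Omega> \<Longrightarrow> cutoff z x = apply_bcontfun z x"
  by (simp add: cutoff_def)

lemma cutoff_bound: "\<bar>cutoff z x\<bar> \<le> norm z"
  using norm_bounded[of z x] by (auto simp: cutoff_def indicator_def)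

lemma cutoff_integrable: "integrable lebesgue (cutoff z)"
  using integrable_bounded_support[OF cutoff_measurable \<Omega>_lmeasurable cutoff_outside cutoff_bound] .

lemma cutoff_diff: "cutoff (z - z') x = cutoff z x - cutoff z' x"
  by (simp add: cutoff_def algebra_simps)

lemma cutoff_L2:
  assumes S: "S = \<Omega> \<or> S = UNIV"
  shows "cutoff z \<in> L2_space S"
    and "L2_norm S (cutoff z) \<le> norm z * sqrt (measure lebesgue \<Omega>)"
proof -
  have m: "cutoff z \<in> borel_measurable (lebesgue_on \<Omega>)"
    by (intro measurable_restrict_space1 cutoff_measurable)
  note b = L2_bounded[OF m \<Omega>_lmeasurable cutoff_bound norm_ge_zero]
  note ext = L2_zero_extension[OF \<Omega>_lmeasurable b(1) cutoff_outside]
  have U: "cutoff z \<in> L2_space UNIV" "L2_norm UNIV (cutoff z) = L2_norm \<Omega> (cutoff z)"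
    using ext by (auto simp: L2_space_def L2_norm_def lebesgue_on_UNIV_eq real_sqrt_abs)
  show "cutoff z \<in> L2_space S" "L2_norm S (cutoff z) \<le> norm z * sqrt (measure lebesgue \<Omega>)"
    using S U b by auto
qed

lemma cutoff_curve:
  assumes S: "S = \<Omega> \<or> S = UNIV" and z: "\<And>t. isCont z t"
  shows "L2_curve S (\<lambda>t. cutoff (z t))"
proof -
  have "((\<lambda>s. L2_norm S (\<lambda>x. cutoff (z s) x - cutoff (z t) x)) \<longlongrightarrow> 0) (at t)" for t
  proof (rule Lim_null_comparison)
    have "((\<lambda>s. norm (z s - z t)) \<longlongrightarrow> 0) (at t)"
      using z[of t] by (simp add: isCont_def tendsto_norm_zero_iff LIM_zero)
    then show "((\<lambda>s. norm (z s - z t) * sqrt (measure lebesgue \<Omega>)) \<longlongrightarrow> 0) (at t)"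
      by (rule tendsto_mult_left_zero)
    show "\<forall>\<^sub>F s in at t. norm (L2_norm S (\<lambda>x. cutoff (z s) x - cutoff (z t) x))
        \<le> norm (z s - z t) * sqrt (measure lebesgue \<Omega>)"
      using cutoff_L2(2)[OF S, of "z s - z t" for s] by (simp add: cutoff_diff[abs_def])
  qed
  then show ?thesis using cutoff_L2(1)[OF S] by (simp add: L2_curve_def)
qed

lemma cutoff_has_derivative:
  assumes S: "S = \<Omega> \<or> S = UNIV" and z: "(z has_vector_derivative z') (at t)"
  shows "L2_has_derivative S UNIV (\<lambda>t. cutoff (z t)) (cutoff z') t"
proof -
  have "((\<lambda>s. L2_norm S (\<lambda>x. (cutoff (z s) x - cutoff (z t) x) / (s - t) - cutoff z' x)) \<longlongrightarrow> 0) (at t)"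
  proof (rule Lim_null_comparison)
    have lim: "((\<lambda>s. norm (z s - z t - (s - t) *\<^sub>R z') / norm (s - t)) \<longlongrightarrow> 0) (at t)"
      using z unfolding has_vector_derivative_def has_derivative_iff_norm by blast
    have "norm (z s - z t - (s - t) *\<^sub>R z') / norm (s - t) = norm ((z s - z t) /\<^sub>R (s - t) - z')"
      if "s \<noteq> t" for s
    proof -
      have "(z s - z t) /\<^sub>R (s - t) - z' = (z s - z t - (s - t) *\<^sub>R z') /\<^sub>R (s - t)"
        unfolding scaleR_diff_right[of _ "z s - z t"] using that by simp
      also have "norm \<dots> = norm (z s - z t - (s - t) *\<^sub>R z') / norm (s - t)"
        unfolding norm_scaleR by (simp add: divide_inverse mult.commute)
      finally show ?thesis by simp
    qed
    then have "((\<lambda>s. norm ((z s - z t) /\<^sub>R (s - t) - z')) \<longlongrightarrow> 0) (at t)"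
      by (intro Lim_transform_eventually[OF lim]) (auto simp: eventually_at_filter)
    then show "((\<lambda>s. norm ((z s - z t) /\<^sub>R (s - t) - z') * sqrt (measure lebesgue \<Omega>)) \<longlongrightarrow> 0) (at t)"
      by (rule tendsto_mult_left_zero)
    have "(\<lambda>x. (cutoff (z s) x - cutoff (z t) x) / (s - t) - cutoff z' x) = cutoff ((z s - z t) /\<^sub>R (s - t) - z')" for s
      by (auto simp: cutoff_def indicator_def divide_inverse mult.commute)
    then show "\<forall>\<^sub>F s in at t. norm (L2_norm S (\<lambda>x. (cutoff (z s) x - cutoff (z t) x) / (s - t) - cutoff z' x))
        \<le> norm ((z s - z t) /\<^sub>R (s - t) - z') * sqrt (measure lebesgue \<Omega>)"
      using cutoff_L2(2)[OF S] by simp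
  qed
  then show ?thesis using cutoff_L2(1)[OF S] by (simp add: L2_has_derivative_def)
qed

text \<open>The right-hand side of the limit equation on bounded continuous functions.\<close>

definition rhs :: "('a \<Rightarrow>\<^sub>C real) \<Rightarrow> ('a \<Rightarrow>\<^sub>C real)" where
  "rhs z = Bcontfun (\<lambda>x. apply_bcontfun Xb x * (LINT y|lebesgue. apply_bcontfun Jb (x - y) * cutoff z y)
     - apply_bcontfun hb x * apply_bcontfun z x
     + apply_bcontfun Xb x * g (1 / apply_bcontfun Xb x * apply_bcontfun z x))"

lemma Jb_convolution:
  assumes "integrable lebesgue w"
  shows "integrable lebesgue (\<lambda>y. apply_bcontfun Jb (x - y) * w y)"
    and "continuous_on UNIV (\<lambda>x. LINT y|lebesgue. apply_bcontfun Jb (x - y) * w y)"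
    and "\<bar>LINT y|lebesgue. apply_bcontfun Jb (x - y) * w y\<bar> \<le> norm Jb * (LINT y|lebesgue. \<bar>w y\<bar>)"
  using convolution_bounded_continuous[of "apply_bcontfun Jb" "norm Jb" w] norm_bounded[of Jb] assms
  by auto

lemma cutoff_L1: "(LINT y|lebesgue. \<bar>cutoff z y\<bar>) \<le> norm z * measure lebesgue \<Omega>"
proof -
  have "(LINT y|lebesgue. \<bar>cutoff z y\<bar>) \<le> sqrt (measure lebesgue \<Omega>) * L2_norm \<Omega> (cutoff z)"
    by (rule L1_le_L2[OF \<Omega>_lmeasurable cutoff_L2(1) cutoff_outside]) auto
  also have "\<dots> \<le> sqrt (measure lebesgue \<Omega>) * (norm z * sqrt (measure lebesgue \<Omega>))"
    by (intro mult_left_mono cutoff_L2(2)) auto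
  finally show ?thesis by (simp add: mult.commute mult.left_commute)
qed

lemma cont_g: "continuous_on UNIV g"
  by (rule lipschitz_on_continuous_on[of L])
    (auto intro!: lipschitz_onI simp: dist_real_def g_lip L_nonneg)

lemma Xb_pos: "0 < apply_bcontfun Xb x"
  using Xb_ge[of x] c_pos by linarith

lemma Xb_inverse_bound: "\<bar>1 / apply_bcontfun Xb x * r\<bar> \<le> 1 / c * \<bar>r\<bar>"
proof -
  have "1 / apply_bcontfun Xb x \<le> 1 / c" using Xb_ge[of x] c_pos by (intro divide_left_mono) auto
  then show ?thesis using Xb_pos[of x] by (simp only: abs_mult) (intro mult_right_mono, auto)
qed

lemma rhs_apply:
  "apply_bcontfun (rhs z) x = apply_bcontfun Xb x * (LINT y|lebesgue. apply_bcontfun Jb (x - y) * cutoff z y)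
     - apply_bcontfun hb x * apply_bcontfun z x
     + apply_bcontfun Xb x * g (1 / apply_bcontfun Xb x * apply_bcontfun z x)"
proof -
  let ?f = "\<lambda>x. apply_bcontfun Xb x * (LINT y|lebesgue. apply_bcontfun Jb (x - y) * cutoff z y)
     - apply_bcontfun hb x * apply_bcontfun z x
     + apply_bcontfun Xb x * g (1 / apply_bcontfun Xb x * apply_bcontfun z x)"
  have "?f \<in> bcontfun"
  proof (rule bcontfun_normI)
    show "continuous_on UNIV ?f"
      by (intro continuous_intros Jb_convolution(2)[OF cutoff_integrable] continuous_on_compose2[OF cont_g])
        (use Xb_pos in \<open>auto simp: less_le\<close>)
    fix x
    have 1: "\<bar>LINT y|lebesgue. apply_bcontfun Jb (x - y) * cutoff z y\<bar> \<le> norm Jb * (norm z * measure lebesgue \<Omega>)"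
      by (rule order_trans[OF Jb_convolution(3)[OF cutoff_integrable]]) (intro mult_left_mono cutoff_L1 norm_ge_zero)
    let ?r = "1 / apply_bcontfun Xb x * apply_bcontfun z x"
    have "\<bar>g ?r\<bar> \<le> \<bar>g 0\<bar> + L * \<bar>?r\<bar>" using g_lip[of ?r 0] by simp
    also have "\<dots> \<le> \<bar>g 0\<bar> + L * (1 / c * norm z)"
      using L_nonneg c_pos norm_bounded[of z x]
      by (intro add_left_mono mult_left_mono order_trans[OF Xb_inverse_bound]) auto
    finally have 2: "\<bar>g ?r\<bar> \<le> \<bar>g 0\<bar> + L * (1 / c * norm z)" .
    have "norm (?f x) \<le> \<bar>apply_bcontfun Xb x\<bar> * \<bar>LINT y|lebesgue. apply_bcontfun Jb (x - y) * cutoff z y\<bar>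
        + \<bar>apply_bcontfun hb x\<bar> * \<bar>apply_bcontfun z x\<bar> + \<bar>apply_bcontfun Xb x\<bar> * \<bar>g ?r\<bar>"
      unfolding real_norm_def abs_mult[symmetric] by linarith
    also have "\<dots> \<le> norm Xb * (norm Jb * (norm z * measure lebesgue \<Omega>)) + norm hb * norm z
        + norm Xb * (\<bar>g 0\<bar> + L * (1 / c * norm z))"
      using norm_bounded[of Xb x] norm_bounded[of hb x] norm_bounded[of z x]
      by (intro add_mono mult_mono 1 2) auto
    finally show "norm (?f x) \<le> norm Xb * (norm Jb * (norm z * measure lebesgue \<Omega>)) + norm hb * norm z
        + norm Xb * (\<bar>g 0\<bar> + L * (1 / c * norm z))" .
  qed
  then show ?thesis by (simp add: rhs_def Bcontfun_inverse)
qed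

lemma rhs_Lipschitz:
  "norm (rhs z - rhs z') \<le> (norm Xb * (norm Jb * measure lebesgue \<Omega>) + norm hb + norm Xb * (L * (1 / c)))
     * norm (z - z')"
proof (rule norm_bound)
  fix x
  let ?d = "z - z'"
  let ?r = "1 / apply_bcontfun Xb x * apply_bcontfun z x"
  let ?r' = "1 / apply_bcontfun Xb x * apply_bcontfun z' x"
  have d: "(LINT y|lebesgue. apply_bcontfun Jb (x - y) * cutoff z y)
      - (LINT y|lebesgue. apply_bcontfun Jb (x - y) * cutoff z' y) =
      (LINT y|lebesgue. apply_bcontfun Jb (x - y) * cutoff ?d y)"
    using Jb_convolution(1)[OF cutoff_integrable] by (simp add: cutoff_diff right_diff_distrib)
  have 1: "\<bar>LINT y|lebesgue. apply_bcontfun Jb (x - y) * cutoff ?d y\<bar> \<le> norm Jb * (norm ?d * measure lebesgue \<Omega>)"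
    by (rule order_trans[OF Jb_convolution(3)[OF cutoff_integrable]]) (intro mult_left_mono cutoff_L1 norm_ge_zero)
  have "\<bar>g ?r - g ?r'\<bar> \<le> L * \<bar>?r - ?r'\<bar>" by (rule g_lip)
  also have "?r - ?r' = 1 / apply_bcontfun Xb x * apply_bcontfun ?d x" by (simp add: diff_divide_distrib)
  also have "L * \<bar>1 / apply_bcontfun Xb x * apply_bcontfun ?d x\<bar> \<le> L * (1 / c * norm ?d)"
    using L_nonneg c_pos norm_bounded[of ?d x]
    by (intro mult_left_mono order_trans[OF Xb_inverse_bound]) (auto simp: divide_right_mono)
  finally have 2: "\<bar>g ?r - g ?r'\<bar> \<le> L * (1 / c * norm ?d)" .
  have "apply_bcontfun (rhs z - rhs z') x =
      apply_bcontfun Xb x * (LINT y|lebesgue. apply_bcontfun Jb (x - y) * cutoff ?d y)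
      - apply_bcontfun hb x * apply_bcontfun ?d x + apply_bcontfun Xb x * (g ?r - g ?r')"
    unfolding d[symmetric] by (simp add: rhs_apply algebra_simps)
  also have "norm \<dots> \<le> \<bar>apply_bcontfun Xb x\<bar> * \<bar>LINT y|lebesgue. apply_bcontfun Jb (x - y) * cutoff ?d y\<bar>
        + \<bar>apply_bcontfun hb x\<bar> * \<bar>apply_bcontfun ?d x\<bar> + \<bar>apply_bcontfun Xb x\<bar> * \<bar>g ?r - g ?r'\<bar>"
    unfolding real_norm_def abs_mult[symmetric] by linarith
  also have "\<dots> \<le> norm Xb * (norm Jb * (norm ?d * measure lebesgue \<Omega>)) + norm hb * norm ?d
        + norm Xb * (L * (1 / c * norm ?d))"
    using norm_bounded[of Xb x] norm_bounded[of hb x] norm_bounded[of ?d x]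
    by (intro add_mono mult_mono 1 2) auto
  finally show "norm (apply_bcontfun (rhs z - rhs z') x) \<le>
      (norm Xb * (norm Jb * measure lebesgue \<Omega>) + norm hb + norm Xb * (L * (1 / c))) * norm ?d"
    by (simp add: algebra_simps)
qed

lemma convolution_eq:
  assumes x: "x \<in> \<Omega>" and w0: "\<And>y. y \<notin> \<Omega> \<Longrightarrow> w y = 0"
  shows "(LINT y|lebesgue. J (x - y) * w y) = (LINT y|lebesgue. apply_bcontfun Jb (x - y) * w y)"
proof (rule Bochner_Integration.integral_cong[OF refl])
  fix y show "J (x - y) * w y = apply_bcontfun Jb (x - y) * w y"
    using J_eq[OF x, of y] w0[of y] by (cases "y \<in> \<Omega>") auto
qed

lemma cutoff_rhs_eq:
  assumes x: "x \<in> \<Omega>"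
  shows "cutoff (rhs z) x = X x * (LINT y|lebesgue. J (x - y) * cutoff z y) - h x * cutoff z x
     + X x * g (1 / X x * cutoff z x)"
  using x convolution_eq[OF x cutoff_outside] by (simp add: cutoff_inside rhs_apply X_eq h_eq)

text \<open>Solutions of the limit equation in the space of bounded continuous functions. The initial value
  is prescribed on \<open>\<Omega>\<close> only, as the values outside have no influence on those in \<open>\<Omega>\<close>.\<close>

definition limit_curve :: "(real \<Rightarrow> 'a \<Rightarrow>\<^sub>C real) \<Rightarrow> bool" where
  "limit_curve v \<longleftrightarrow> (\<forall>x\<in>\<Omega>. apply_bcontfun (v 0) x = X x * u\<^sub>0 x) \<and>
     (\<forall>t. (v has_vector_derivative rhs (v t)) (at t))"

lemma ex_limit_curve: "\<exists>v. limit_curve v"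
proof -
  define z where "z = Bcontfun (\<lambda>x. apply_bcontfun Xb x * apply_bcontfun ub x)"
  have "(\<lambda>x. apply_bcontfun Xb x * apply_bcontfun ub x) \<in> bcontfun"
  proof (rule bcontfun_normI)
    show "norm (apply_bcontfun Xb x * apply_bcontfun ub x) \<le> norm Xb * norm ub" for x
      using norm_bounded[of Xb x] norm_bounded[of ub x] by (simp add: abs_mult mult_mono)
  qed (intro continuous_on_mult continuous_on_apply_bcontfun)
  then have z: "apply_bcontfun z x = apply_bcontfun Xb x * apply_bcontfun ub x" for x
    by (simp add: z_def Bcontfun_inverse)
  obtain v where "v 0 = z" "\<And>t. (v has_vector_derivative rhs (v t)) (at t)"
    using Lipschitz_ode_global_solution[OF rhs_Lipschitz, of z] c_pos L_nonneg by auto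
  then show ?thesis unfolding limit_curve_def using z X_eq u\<^sub>0_eq by (intro exI[of _ v]) auto
qed

lemma limit_curve_isCont: "limit_curve v \<Longrightarrow> isCont v t"
  unfolding limit_curve_def using has_vector_derivative_continuous by blast

lemma limit_curve_rhs_isCont: "limit_curve v \<Longrightarrow> isCont (\<lambda>t. rhs (v t)) t"
proof -
  assume v: "limit_curve v"
  have "continuous_on UNIV rhs"
    by (rule lipschitz_on_continuous_on[OF lipschitz_onI[OF rhs_Lipschitz[folded dist_norm]]])
      (use c_pos L_nonneg in auto)
  then have "isCont rhs (v t)" by (simp add: continuous_on_eq_continuous_at)
  then show ?thesis by (rule isCont_o2[OF limit_curve_isCont[OF v]])
qed

lemma limit_curve_C1:
  assumes S: "S = \<Omega> \<or> S = UNIV" and v: "limit_curve v"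
  shows "C1_L2 S I (\<lambda>t. cutoff (v t))"
  by (rule C1_L2_if_derivative[OF cutoff_has_derivative[OF S] cutoff_curve[OF S]])
    (use v limit_curve_rhs_isCont in \<open>auto simp: limit_curve_def\<close>)

lemma limit_curve_solution:
  assumes v: "limit_curve v"
  shows "nonlocal_solution \<Omega> J X h g (\<lambda>x w. 1 / X x * w x) u\<^sub>0 (\<lambda>t. cutoff (v t))"
  unfolding nonlocal_solution_def
proof (intro conjI allI impI)
  show "C1_L2 \<Omega> {a..b} (\<lambda>t. cutoff (v t))" for a b by (rule limit_curve_C1[OF _ v]) simp
  show "x \<notin> \<Omega> \<Longrightarrow> cutoff (v t) x = 0" for t x by (rule cutoff_outside)
  show "AE x in lebesgue_on \<Omega>. cutoff (v 0) x = X x * u\<^sub>0 x"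
    using v by (intro AE_I2) (auto simp: limit_curve_def cutoff_inside)
  fix t
  have d: "L2_has_derivative \<Omega> UNIV (\<lambda>t. cutoff (v t)) (cutoff (rhs (v t))) t"
    using v by (intro cutoff_has_derivative) (auto simp: limit_curve_def)
  let ?R = "\<lambda>x. X x * (LINT y|lebesgue. J (x - y) * cutoff (v t) y) - h x * cutoff (v t) x
      + X x * g (1 / X x * cutoff (v t) x)"
  have "?R \<in> L2_space \<Omega>"
    using d L2_space_cong[of \<Omega> "cutoff (rhs (v t))" ?R] cutoff_rhs_eq by (auto simp: L2_has_derivative_def)
  moreover have "L2_norm \<Omega> (\<lambda>x. (cutoff (v s) x - cutoff (v t) x) / (s - t) - ?R x) =
      L2_norm \<Omega> (\<lambda>x. (cutoff (v s) x - cutoff (v t) x) / (s - t) - cutoff (rhs (v t)) x)" for s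
    by (intro L2_norm_cong) (simp only: cutoff_rhs_eq)
  ultimately show "L2_has_derivative \<Omega> UNIV (\<lambda>t. cutoff (v t)) ?R t"
    using d unfolding L2_has_derivative_def by simp
qed

end

section \<open>Convergence to the limit equation\<close>

context nonlocal_problem
begin

text \<open>The error made by replacing the local mean by its limit, for a function that does not depend
  on \<open>\<delta>\<close>.\<close>

definition residual :: "('a \<Rightarrow>\<^sub>C real) \<Rightarrow> real \<Rightarrow> 'a \<Rightarrow> real" where
  "residual z \<delta> x = local_mean X \<delta> x (cutoff z) - 1 / X x * cutoff z x"

lemma residual_measurable: "residual z \<delta> \<in> borel_measurable (lebesgue_on \<Omega>)"
  unfolding residual_def[abs_def]
  by (intro measurable_restrict_space1 borel_measurable_diff borel_measurable_times borel_measurable_divide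
      local_mean_measurable cutoff_measurable X_measurable borel_measurable_const)

lemma residual_bound:
  assumes "x \<in> \<Omega>" "\<delta> > 0"
  shows "\<bar>residual z \<delta> x\<bar> \<le> 2 / c * norm z"
proof -
  have 1: "\<bar>local_mean X \<delta> x (cutoff z)\<bar> \<le> norm z / c"
    using local_mean_bounded[OF cutoff_integrable cutoff_outside cutoff_bound assms] .
  have "\<bar>1 / X x * cutoff z x\<bar> \<le> 1 / c * \<bar>cutoff z x\<bar>"
    using Xb_inverse_bound[of x "cutoff z x"] X_eq[OF assms(1)] by simp
  also have "\<dots> \<le> 1 / c * norm z" using c_pos cutoff_bound by (intro mult_left_mono) auto
  finally have 2: "\<bar>1 / X x * cutoff z x\<bar> \<le> norm z / c" by simp
  have "2 / c * norm z = norm z / c + norm z / c" by simp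
  then show ?thesis using 1 2 unfolding residual_def by linarith
qed

lemma residual_L2:
  assumes "\<delta> > 0"
  shows "residual z \<delta> \<in> L2_space \<Omega>"
    and "L2_norm \<Omega> (residual z \<delta>) \<le> 2 / c * norm z * sqrt (measure lebesgue \<Omega>)"
  using L2_bounded[OF residual_measurable \<Omega>_lmeasurable residual_bound[OF _ assms]] c_pos by auto

lemma residual_diff: "residual (z - z') \<delta> x = residual z \<delta> x - residual z' \<delta> x"
  using local_mean_diff[OF cutoff_integrable cutoff_integrable, of \<delta> x z z']
  by (simp add: residual_def cutoff_diff[abs_def] right_diff_distrib diff_divide_distrib)

text \<open>The residual tends to \<open>0\<close> at every point of the open set \<open>\<Omega>\<close>, where \<open>z\<close> and \<open>X\<close> are
  continuous, and is dominated by a constant.\<close>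

lemma residual_tendsto_0: "((\<lambda>\<delta>. L2_norm \<Omega> (residual z \<delta>)) \<longlongrightarrow> 0) (at_right 0)"
  unfolding tendsto_at_iff_sequentially
proof (intro allI impI)
  fix d :: "nat \<Rightarrow> real" assume d: "\<forall>i. d i \<in> {0<..} - {0}" and d0: "d \<longlonglongrightarrow> 0"
  then have dpos: "d i > 0" for i by auto
  have dr: "filterlim d (at_right 0) sequentially"
    using d0 dpos by (intro tendsto_imp_filterlim_at_right) auto
  have "(\<lambda>i. LINT x|lebesgue_on \<Omega>. (residual z (d i) x)\<^sup>2) \<longlonglongrightarrow> (LINT x|lebesgue_on \<Omega>. 0)"
  proof (rule integral_dominated_convergence)
    show "integrable (lebesgue_on \<Omega>) (\<lambda>x. (2 / c * norm z)\<^sup>2)"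
      using \<Omega>_lmeasurable by (auto simp: integrable_restrict_space fmeasurable_def)
    show "(\<lambda>x. (residual z (d i) x)\<^sup>2) \<in> borel_measurable (lebesgue_on \<Omega>)" for i
      by (intro borel_measurable_power residual_measurable)
    have "\<bar>residual z (d i) x\<bar>\<^sup>2 \<le> (2 / c * norm z)\<^sup>2" if "x \<in> \<Omega>" for i x
      by (intro power_mono residual_bound dpos that) auto
    then show "AE x in lebesgue_on \<Omega>. norm ((residual z (d i) x)\<^sup>2) \<le> (2 / c * norm z)\<^sup>2" for i
      by (intro AE_I2) auto
    show "AE x in lebesgue_on \<Omega>. (\<lambda>i. (residual z (d i) x)\<^sup>2) \<longlonglongrightarrow> 0"
    proof (rule AE_I2)
      fix x assume "x \<in> space (lebesgue_on \<Omega>)"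
      then have x: "x \<in> \<Omega>" by simp
      have eq: "isCont f x \<longleftrightarrow> isCont f' x" if "\<And>y. y \<in> \<Omega> \<Longrightarrow> f y = f' y" for f f' :: "'a \<Rightarrow> real"
        by (rule isCont_cong) (use eventually_nhds_in_open[OF open_\<Omega> x] that in \<open>auto elim: eventually_mono\<close>)
      have cb: "isCont (apply_bcontfun w) x" for w
        using continuous_on_apply_bcontfun[of UNIV w] continuous_on_eq_continuous_at[OF open_UNIV]
        by blast
      have "((\<lambda>\<delta>. local_mean X \<delta> x (cutoff z)) \<longlongrightarrow> 1 / X x * cutoff z x) (at_right 0)"
        using eq[of "cutoff z" "apply_bcontfun z"] eq[of X "apply_bcontfun Xb"] cb
        by (intro local_mean_tendsto cutoff_integrable x) (auto simp: cutoff_inside X_eq)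
      then have "((\<lambda>\<delta>. residual z \<delta> x) \<longlongrightarrow> 0) (at_right 0)"
        unfolding residual_def by (rule LIM_zero)
      then have "(\<lambda>i. residual z (d i) x) \<longlonglongrightarrow> 0"
        by (rule filterlim_compose[OF _ dr])
      from tendsto_power[OF this, of 2] show "(\<lambda>i. (residual z (d i) x)\<^sup>2) \<longlonglongrightarrow> 0" by simp
    qed
  qed simp
  from tendsto_real_sqrt[OF this] show "((\<lambda>\<delta>. L2_norm \<Omega> (residual z \<delta>)) \<circ> d) \<longlonglongrightarrow> 0"
    by (simp add: L2_norm_def o_def)
qed

text \<open>Along a continuous curve the convergence is locally uniform in time, because the operators
  \<open>z \<mapsto> residual z \<delta>\<close> are bounded uniformly in \<open>\<delta>\<close>.\<close>

lemma residual_uniform: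
  assumes v: "\<And>t. isCont v t" and e: "e > 0"
  shows "\<forall>\<^sub>F \<delta> in at_right 0. \<forall>t\<in>{-T..T::real}. L2_norm \<Omega> (residual (v t) \<delta>) \<le> e"
proof -
  define k where "k = 2 / c * sqrt (measure lebesgue \<Omega>) + 1"
  have "0 \<le> 2 / c * sqrt (measure lebesgue \<Omega>)" using c_pos by simp
  then have k: "k > 0" by (simp add: k_def)
  define U where "U s = {t. norm (v t - v s) < e / (2 * k)}" for s
  have cv: "continuous_on UNIV v" using v by (simp add: continuous_on_eq_continuous_at)
  have opn: "open (U s)" for s
    unfolding U_def by (intro open_Collect_less continuous_intros cv)
  have cover: "{-T..T} \<subseteq> (\<Union>s\<in>{-T..T}. U s)" using e k by (auto simp: U_def)
  obtain C where C: "C \<subseteq> {-T..T}" "finite C" "{-T..T} \<subseteq> (\<Union>s\<in>C. U s)"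
    by (rule compactE_image[OF compact_Icc opn cover])
  have "\<forall>\<^sub>F \<delta> in at_right 0. \<forall>s\<in>C. L2_norm \<Omega> (residual (v s) \<delta>) < e / 2"
    using C(2) order_tendstoD(2)[OF residual_tendsto_0, of "e / 2"] e by (intro eventually_ball_finite) auto
  moreover have "\<forall>\<^sub>F \<delta> in at_right 0. (0::real) < \<delta>" by (rule eventually_at_right_less)
  ultimately show ?thesis
  proof eventually_elim
    case (elim \<delta>)
    show ?case
    proof
      fix t assume "t \<in> {-T..T}"
      then obtain s where s: "s \<in> C" "norm (v t - v s) < e / (2 * k)" using C(3) by (auto simp: U_def)
      have "L2_norm \<Omega> (\<lambda>x. residual (v t) \<delta> x - residual (v s) \<delta> x)
          \<le> 2 / c * norm (v t - v s) * sqrt (measure lebesgue \<Omega>)"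
        using residual_L2(2)[OF elim(2), of "v t - v s"] by (simp add: residual_diff[abs_def])
      also have "\<dots> \<le> k * norm (v t - v s)"
        by (simp add: k_def algebra_simps)
      also have "\<dots> \<le> k * (e / (2 * k))" using s(2) k by (intro mult_left_mono) auto
      also have "\<dots> = e / 2" using k by simp
      finally show "L2_norm \<Omega> (residual (v t) \<delta>) \<le> e"
        using L2_norm_abs_diff[OF residual_L2(1)[OF elim(2)] residual_L2(1)[OF elim(2)], of "v t" "v s"]
          elim(1) s(1) by fastforce
    qed
  qed
qed

text \<open>The time derivative \<open>w'\<close> of the difference \<open>w\<close> of the solutions with the local mean and of
  the limit equation: the linear terms and the local mean of \<open>w\<close> contribute a multiple of the norm
  of \<open>w\<close>, and the residual is the inhomogeneity. Here \<open>G\<close> is the difference of the values of \<open>g\<close>.\<close>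

lemma difference_rate_bound:
  assumes w: "w \<in> L2_space \<Omega>" "\<And>x. x \<notin> \<Omega> \<Longrightarrow> w x = 0" and \<delta>: "\<delta> > 0"
    and lm: "(\<lambda>x. local_mean X \<delta> x w) \<in> L2_space \<Omega>"
      "L2_norm \<Omega> (\<lambda>x. local_mean X \<delta> x w) \<le> k * L2_norm \<Omega> w"
    and w': "w' \<in> L2_space \<Omega>"
    and eq: "\<And>x. x \<in> \<Omega> \<Longrightarrow> w' x = X x * (LINT y|lebesgue. J (x - y) * w y) - h x * w x + X x * G x"
    and G: "\<And>x. x \<in> \<Omega> \<Longrightarrow> \<bar>G x\<bar> \<le> L * \<bar>local_mean X \<delta> x w\<bar> + L * \<bar>residual z \<delta> x\<bar>"
  shows "L2_norm \<Omega> w' \<le> (norm Jb * measure lebesgue \<Omega> + norm hb + L * k) * L2_norm \<Omega> w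
      + L * L2_norm \<Omega> (residual z \<delta>)"
proof -
  let ?n = "L2_norm \<Omega>" and ?s = "sqrt (measure lebesgue \<Omega>)"
  have wi: "integrable lebesgue w"
    by (rule L2_zero_extension(4)[OF \<Omega>_lmeasurable w])
  define a where "a = norm Jb * (?s * ?n w)"
  have a: "0 \<le> a" by (simp add: a_def)
  have one: "(\<lambda>x. a) \<in> L2_space \<Omega>" "?n (\<lambda>x. a) \<le> a * ?s"
    by (rule L2_bounded(1)[OF _ \<Omega>_lmeasurable, of _ a]; use a in auto)
      (rule L2_bounded(2)[OF _ \<Omega>_lmeasurable]; use a in auto)
  define b where "b x = norm hb * \<bar>w x\<bar>" for x
  define l where "l x = L * \<bar>local_mean X \<delta> x w\<bar>" for x
  define r where "r x = L * \<bar>residual z \<delta> x\<bar>" for x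
  have b: "b \<in> L2_space \<Omega>" "?n b = norm hb * ?n w"
    unfolding b_def[abs_def] using L2_abs[OF w(1)] by (auto simp: L2_norm_cmult intro: L2_space_cmult)
  have l: "l \<in> L2_space \<Omega>" "?n l = L * ?n (\<lambda>x. local_mean X \<delta> x w)"
    unfolding l_def[abs_def] using L2_abs[OF lm(1)] L_nonneg by (auto simp: L2_norm_cmult intro: L2_space_cmult)
  have r: "r \<in> L2_space \<Omega>" "?n r = L * ?n (residual z \<delta>)"
    unfolding r_def[abs_def] using L2_abs[OF residual_L2(1)[OF \<delta>, of z]] L_nonneg
    by (auto simp: L2_norm_cmult intro: L2_space_cmult)
  have lr: "(\<lambda>x. l x + r x) \<in> L2_space \<Omega>" using l(1) r(1) by (rule L2_space_add)
  have blr: "(\<lambda>x. b x + (l x + r x)) \<in> L2_space \<Omega>" using b(1) lr by (rule L2_space_add)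
  have ablr: "(\<lambda>x. a + (b x + (l x + r x))) \<in> L2_space \<Omega>" using one(1) blr by (rule L2_space_add)
  have ptw: "\<bar>w' x\<bar> \<le> 1 * \<bar>a + (b x + (l x + r x))\<bar>" if x: "x \<in> \<Omega>" for x
  proof -
    let ?I = "LINT y|lebesgue. J (x - y) * w y"
    have Ib: "?I = (LINT y|lebesgue. apply_bcontfun Jb (x - y) * w y)"
      by (rule convolution_eq) (use x w in auto)
    have I: "\<bar>?I\<bar> \<le> a"
      unfolding Ib a_def
      by (rule order_trans[OF Jb_convolution(3)[OF wi]])
        (intro mult_left_mono L1_le_L2 \<Omega>_lmeasurable w norm_ge_zero)
    have h: "\<bar>h x * w x\<bar> \<le> b x"
      using norm_bounded[of hb x] h_eq[OF x] by (simp add: b_def abs_mult mult_right_mono)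
    have XI: "\<bar>X x * s\<bar> \<le> \<bar>s\<bar>" for s
      using mult_right_mono[OF X_abs[of x], of "\<bar>s\<bar>"] by (simp add: abs_mult)
    have "\<bar>w' x\<bar> \<le> \<bar>X x * ?I\<bar> + \<bar>h x * w x\<bar> + \<bar>X x * G x\<bar>" unfolding eq[OF x] by linarith
    also have "\<dots> \<le> a + b x + (l x + r x)"
      using XI[of ?I] XI[of "G x"] I h G[OF x] unfolding l_def r_def by linarith
    finally show ?thesis by (simp add: add.assoc)
  qed
  have "?n w' \<le> 1 * ?n (\<lambda>x. a + (b x + (l x + r x)))"
    using L2_dominated(2)[OF L2_spaceD(1)[OF w'] ablr ptw] by simp
  also have "\<dots> \<le> ?n (\<lambda>x. a) + (?n b + (?n l + ?n r))"
    using L2_norm_triangle[OF one(1) blr] L2_norm_triangle[OF b(1) lr] L2_norm_triangle[OF l(1) r(1)] by simp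
  also have "\<dots> \<le> a * ?s + (norm hb * ?n w + (L * (k * ?n w) + L * ?n (residual z \<delta>)))"
    unfolding b(2) l(2) r(2) using one(2) lm(2) L_nonneg by (intro add_mono mult_left_mono order_refl)
  also have "a * ?s = norm Jb * (?s * ?s) * ?n w" by (simp add: a_def algebra_simps)
  finally show ?thesis by (simp add: algebra_simps)
qed

lemma solutions_converge_uniformly:
  assumes v: "limit_curve v"
    and u: "\<And>\<delta>. \<delta> > 0 \<Longrightarrow> nonlocal_solution \<Omega> J X h g (local_mean X \<delta>) u\<^sub>0 (u \<delta>)"
    and e: "e > 0"
  shows "\<forall>\<^sub>F \<delta> in at_right 0. \<forall>t\<in>{-T..T}. L2_norm \<Omega> (\<lambda>x. u \<delta> t x - cutoff (v t) x) \<le> e"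
proof -
  obtain n :: real where n: "n > 0" and cov: "\<And>(S::'a set) \<delta> y. open S \<Longrightarrow> bounded S \<Longrightarrow> \<delta> > 0 \<Longrightarrow>
     (\<integral>\<^sup>+x. ennreal (indicator (S \<inter> ball y \<delta>) x * (1 / measure lborel (S \<inter> ball x \<delta>))) \<partial>lborel)
       \<le> ennreal n"
    using covering_bound[where 'a='a] by blast
  define k where "k = sqrt n / c"
  have k: "k \<ge> 0" using n c_pos by (simp add: k_def)
  \<comment> \<open>\<open>K\<^sub>0\<close> bounds the rate of change of the difference by its norm; \<open>K\<close> also absorbs the square that
    splitting \<open>2 * L * \<parallel>w\<parallel> * \<rho>\<close> produces, and the summand \<open>1\<close> makes it positive.\<close>
  define K\<^sub>0 where "K\<^sub>0 = norm Jb * measure lebesgue \<Omega> + norm hb + L * k"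
  have K\<^sub>0: "K\<^sub>0 \<ge> 0" using k L_nonneg by (simp add: K\<^sub>0_def)
  define K where "K = 2 * K\<^sub>0 + L + 1"
  have K: "K > 0" using K\<^sub>0 L_nonneg by (simp add: K_def)
  define Q where "Q = L / K * exp (K * T)"
  have Q: "Q \<ge> 0" using K L_nonneg by (simp add: Q_def)
  \<comment> \<open>If the residuals are at most \<open>\<rho>\<close>, Gronwall's inequality bounds the squared norm by \<open>Q * \<rho>\<^sup>2\<close>.\<close>
  define \<rho> where "\<rho> = e / sqrt (Q + 1)"
  have \<rho>: "\<rho> > 0" using e Q by (simp add: \<rho>_def)
  have \<rho>2: "Q * \<rho>\<^sup>2 \<le> e\<^sup>2"
  proof -
    have "Q * \<rho>\<^sup>2 = e\<^sup>2 * (Q / (Q + 1))" using Q by (simp add: \<rho>_def power_divide)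
    also have "\<dots> \<le> e\<^sup>2 * 1" using Q by (intro mult_left_mono) auto
    finally show ?thesis by simp
  qed
  have "\<forall>\<^sub>F \<delta> in at_right 0. (0::real) < \<delta>" by (rule eventually_at_right_less)
  moreover have "\<forall>\<^sub>F \<delta> in at_right 0. \<forall>t\<in>{-T..T}. L2_norm \<Omega> (residual (v t) \<delta>) \<le> \<rho>"
    by (rule residual_uniform[OF limit_curve_isCont[OF v] \<rho>])
  ultimately show ?thesis
  proof eventually_elim
    case (elim \<delta>)
    note \<delta> = elim(1) and res = elim(2)
    define U where "U t x = X x * (LINT y|lebesgue. J (x - y) * u \<delta> t y) - h x * u \<delta> t x
        + X x * g (local_mean X \<delta> x (u \<delta> t))" for t x
    have du: "L2_has_derivative \<Omega> UNIV (u \<delta>) (U t) t" for t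
      using u[OF \<delta>] by (simp add: nonlocal_solution_def U_def[abs_def])
    have dv: "L2_has_derivative \<Omega> UNIV (\<lambda>t. cutoff (v t)) (cutoff (rhs (v t))) t" for t
      using v by (intro cutoff_has_derivative) (auto simp: limit_curve_def)
    define w where "w t x = u \<delta> t x - cutoff (v t) x" for t x
    define w' where "w' t x = U t x - cutoff (rhs (v t)) x" for t x
    have dw: "L2_has_derivative \<Omega> UNIV w (w' t) t" for t
      using L2_has_derivative_diff[OF du dv, of t] by (simp add: w_def[abs_def] w'_def[abs_def])
    have wL: "w t \<in> L2_space \<Omega>" and w'L: "w' t \<in> L2_space \<Omega>" and uL: "u \<delta> t \<in> L2_space \<Omega>" for t
      using dw[of t] du[of t] by (auto simp: L2_has_derivative_def)
    have u0: "u \<delta> t x = 0" if "x \<notin> \<Omega>" for t x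
      using u[OF \<delta>] that by (simp add: nonlocal_solution_def)
    have w0: "w t x = 0" if "x \<notin> \<Omega>" for t x
      using u0[OF that] cutoff_outside[OF that] by (simp add: w_def)
    have ui: "integrable lebesgue (u \<delta> t)" for t
      by (rule L2_zero_extension(4)[OF \<Omega>_lmeasurable uL u0])
    have lmd: "local_mean X \<delta> x (w t) = local_mean X \<delta> x (u \<delta> t) - local_mean X \<delta> x (cutoff (v t))" for x t
      unfolding w_def[abs_def] by (rule local_mean_diff[OF ui cutoff_integrable])
    define \<phi> where "\<phi> t = (L2_norm \<Omega> (w t))\<^sup>2" for t
    define \<phi>' where "\<phi>' t = 2 * (LINT x|lebesgue_on \<Omega>. w t x * w' t x)" for t
    have d\<phi>: "(\<phi> has_real_derivative \<phi>' t) (at t)" for t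
      unfolding \<phi>_def[abs_def] \<phi>'_def by (rule L2_norm_power2_has_derivative[OF dw])
    have "\<phi> 0 = 0"
    proof -
      have "AE x in lebesgue_on \<Omega>. u \<delta> 0 x = X x * u\<^sub>0 x"
        using u[OF \<delta>] by (simp add: nonlocal_solution_def)
      moreover have "AE x in lebesgue_on \<Omega>. x \<in> \<Omega>" by (rule AE_I2) simp
      ultimately have "AE x in lebesgue_on \<Omega>. (w 0 x)\<^sup>2 = 0"
        by eventually_elim (use v in \<open>simp add: w_def cutoff_inside limit_curve_def\<close>)
      then show ?thesis unfolding \<phi>_def L2_norm_power2 by (rule integral_eq_zero_AE)
    qed
    moreover have "\<bar>\<phi>' t\<bar> \<le> K * \<phi> t + L * \<rho>\<^sup>2" if t: "t \<in> {-T..T}" for t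
    proof -
      let ?n = "L2_norm \<Omega> (w t)"
      define G where "G x = g (local_mean X \<delta> x (u \<delta> t)) - g (1 / X x * cutoff (v t) x)" for x
      have "L2_norm \<Omega> (w' t) \<le> K\<^sub>0 * ?n + L * L2_norm \<Omega> (residual (v t) \<delta>)"
        unfolding K\<^sub>0_def
      proof (rule difference_rate_bound[OF wL w0 \<delta>])
        show "(\<lambda>x. local_mean X \<delta> x (w t)) \<in> L2_space \<Omega>"
          "L2_norm \<Omega> (\<lambda>x. local_mean X \<delta> x (w t)) \<le> k * ?n"
          unfolding k_def using local_mean_L2[OF wL w0 \<delta> _ cov[OF open_\<Omega> bounded_\<Omega> \<delta>]] n by auto
        show "w' t \<in> L2_space \<Omega>" by (rule w'L)
        fix x assume x: "x \<in> \<Omega>"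
        have "(LINT y|lebesgue. J (x - y) * w t y) =
            (LINT y|lebesgue. apply_bcontfun Jb (x - y) * w t y)"
          by (rule convolution_eq[OF x w0])
        also have "\<dots> = (LINT y|lebesgue. apply_bcontfun Jb (x - y) * u \<delta> t y) -
            (LINT y|lebesgue. apply_bcontfun Jb (x - y) * cutoff (v t) y)"
          using Jb_convolution(1)[OF ui] Jb_convolution(1)[OF cutoff_integrable]
          by (simp add: w_def right_diff_distrib)
        also have "\<dots> = (LINT y|lebesgue. J (x - y) * u \<delta> t y) - (LINT y|lebesgue. J (x - y) * cutoff (v t) y)"
          using convolution_eq[OF x, of "u \<delta> t", OF u0]
            convolution_eq[OF x, of "cutoff (v t)", OF cutoff_outside] by simp
        finally show "w' t x = X x * (LINT y|lebesgue. J (x - y) * w t y) - h x * w t x + X x * G x"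
          unfolding w'_def U_def cutoff_rhs_eq[OF x] G_def
          by (simp only:) (simp add: w_def algebra_simps)
        have "\<bar>G x\<bar> \<le> L * \<bar>local_mean X \<delta> x (u \<delta> t) - 1 / X x * cutoff (v t) x\<bar>"
          unfolding G_def by (rule g_lip)
        also have "local_mean X \<delta> x (u \<delta> t) - 1 / X x * cutoff (v t) x =
            local_mean X \<delta> x (w t) + residual (v t) \<delta> x" by (simp add: lmd residual_def)
        also have "L * \<bar>\<dots>\<bar> \<le> L * (\<bar>local_mean X \<delta> x (w t)\<bar> + \<bar>residual (v t) \<delta> x\<bar>)"
          by (intro mult_left_mono abs_triangle_ineq L_nonneg)
        finally show "\<bar>G x\<bar> \<le> L * \<bar>local_mean X \<delta> x (w t)\<bar> + L * \<bar>residual (v t) \<delta> x\<bar>"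
          by (simp add: distrib_left)
      qed
      also have "\<dots> \<le> K\<^sub>0 * ?n + L * \<rho>"
        using res t L_nonneg by (intro add_left_mono mult_left_mono) auto
      finally have w'b: "L2_norm \<Omega> (w' t) \<le> K\<^sub>0 * ?n + L * \<rho>" .
      have "\<bar>\<phi>' t\<bar> \<le> 2 * (?n * L2_norm \<Omega> (w' t))"
        unfolding \<phi>'_def using L2_Cauchy_Schwarz[OF wL w'L, of t t] by (simp add: abs_mult)
      also have "\<dots> \<le> 2 * (?n * (K\<^sub>0 * ?n + L * \<rho>))"
        by (intro mult_left_mono w'b) auto
      also have "\<dots> = 2 * K\<^sub>0 * ?n\<^sup>2 + L * (2 * ?n * \<rho>)"
        by (simp add: power2_eq_square algebra_simps)
      also have "\<dots> \<le> 2 * K\<^sub>0 * ?n\<^sup>2 + L * (?n\<^sup>2 + \<rho>\<^sup>2)"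
        by (intro add_left_mono mult_left_mono sum_squares_bound L_nonneg)
      also have "\<dots> \<le> K * \<phi> t + L * \<rho>\<^sup>2"
        by (simp add: \<phi>_def K_def algebra_simps)
      finally show ?thesis .
    qed
    ultimately have \<phi>le: "\<phi> t \<le> L * \<rho>\<^sup>2 / K * exp (K * T)" if "t \<in> {-T..T}" for t
      by (rule Gronwall_two_sided[OF d\<phi> _ _ K _ that]) (use L_nonneg in auto)
    show ?case
    proof
      fix t assume "t \<in> {-T..T}"
      from \<phi>le[OF this] have "(L2_norm \<Omega> (w t))\<^sup>2 \<le> Q * \<rho>\<^sup>2"
        by (simp add: \<phi>_def Q_def mult_ac)
      also note \<rho>2
      finally show "L2_norm \<Omega> (\<lambda>x. u \<delta> t x - cutoff (v t) x) \<le> e"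
        using e unfolding w_def[abs_def] by (intro power2_le_imp_le[of "L2_norm \<Omega> _" e]) auto
    qed
  qed
qed

lemma solutions_converge_to_limit:
  assumes u: "\<And>\<delta>. \<delta> > 0 \<Longrightarrow> nonlocal_solution \<Omega> J X h g (local_mean X \<delta>) u\<^sub>0 (u \<delta>)"
  shows "\<exists>ubar :: real \<Rightarrow> 'a \<Rightarrow> real.
      (\<forall>t x. x \<notin> \<Omega> \<longrightarrow> ubar t x = 0) \<and>
      (\<forall>a b. a < b \<longrightarrow> C1_L2 UNIV {a..b} ubar) \<and>
      (\<forall>a b. a < b \<longrightarrow> Linf_L2_weakstar_tendsto \<Omega> {a..b} u ubar (at_right 0)) \<and>
      nonlocal_solution \<Omega> J X h g (\<lambda>x w. 1 / X x * w x) u\<^sub>0 ubar"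
proof -
  obtain v where v: "limit_curve v" using ex_limit_curve by blast
  have weak: "Linf_L2_weakstar_tendsto \<Omega> {a..b} u (\<lambda>t. cutoff (v t)) (at_right 0)" for a b
  proof (rule uniform_imp_weakstar)
    show "L2_curve \<Omega> (\<lambda>t. cutoff (v t))"
      by (rule cutoff_curve[OF _ limit_curve_isCont[OF v]]) simp
    have "L2_curve \<Omega> (u \<delta>)" if "\<delta> > 0" for \<delta>
      by (rule L2_has_derivative_imp_curve) (use u[OF that] in \<open>auto simp: nonlocal_solution_def\<close>)
    then show "\<forall>\<^sub>F \<delta> in at_right 0. L2_curve \<Omega> (u \<delta>)"
      using eventually_at_right_less[of "0::real"] by (auto elim: eventually_mono)
    fix e :: real assume "e > 0"
    let ?T = "max \<bar>a\<bar> \<bar>b\<bar>"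
    have "{a..b} \<subseteq> {-?T..?T}" by auto
    with solutions_converge_uniformly[OF v u \<open>e > 0\<close>, of ?T]
    show "\<forall>\<^sub>F \<delta> in at_right 0. \<forall>t\<in>{a..b}. L2_norm \<Omega> (\<lambda>x. u \<delta> t x - cutoff (v t) x) \<le> e"
      by (auto elim!: eventually_mono)
  qed
  show ?thesis
    by (rule exI[of _ "\<lambda>t. cutoff (v t)"])
      (use weak limit_curve_solution[OF v] limit_curve_C1[OF _ v] cutoff_outside in auto)
qed

end

section \<open>Reduction to bounded continuous data\<close>

lemma has_bochner_integral_reflect_translate:
  fixes J :: "'a::euclidean_space \<Rightarrow> real"
  assumes cont: "continuous_on UNIV J" and J: "has_bochner_integral lebesgue J r"
  shows "has_bochner_integral lebesgue (\<lambda>y. J (x - y)) r"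
proof -
  have Jm: "J \<in> borel_measurable borel" by (rule borel_measurable_continuous_onI[OF cont])
  have m: "(\<lambda>y. x - y) \<in> borel_measurable (borel :: 'a measure)"
    by (intro borel_measurable_continuous_onI continuous_intros)
  have Jxm: "(\<lambda>y. J (x - y)) \<in> borel_measurable borel" by (rule measurable_compose[OF m Jm])
  have distr: "distr lborel borel (\<lambda>y. x - y) = lborel"
    using lborel_affine[of "-1" x] by (simp add: density_1)
  have "has_bochner_integral lborel J r"
    using J Jm by (simp add: has_bochner_integral_iff integrable_completion integral_completion)
  then have "has_bochner_integral (distr lborel borel (\<lambda>y. x - y)) J r" unfolding distr .
  then have "has_bochner_integral lborel (\<lambda>y. J (x - y)) r"
    using Jm m by (simp add: has_bochner_integral_iff integrable_distr_eq integral_distr)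
  then show ?thesis
    using Jxm by (simp add: has_bochner_integral_iff integrable_completion integral_completion)
qed

lemma C1_imp_continuous: "C1 f \<Longrightarrow> continuous_on UNIV f"
  unfolding C1_def using has_derivative_continuous continuous_at_imp_continuous_on by blast

text \<open>Truncation of the values: on a bounded set a continuous function coincides with a bounded
  continuous one.\<close>

lemma ex_bcontfun_eq_on_bounded:
  fixes f :: "'a::euclidean_space \<Rightarrow> real"
  assumes f: "continuous_on UNIV f" and S: "bounded S"
  shows "\<exists>z :: 'a \<Rightarrow>\<^sub>C real. \<forall>x\<in>S. f x = apply_bcontfun z x"
proof -
  have "bounded (f ` closure S)"
    using S by (intro compact_imp_bounded compact_continuous_image continuous_on_subset[OF f])
      (auto simp: compact_closure)
  then obtain B where "\<forall>y\<in>f ` closure S. norm y \<le> B" unfolding bounded_iff by blast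
  then have B: "\<bar>f x\<bar> \<le> B" if "x \<in> S" for x using that closure_subset[of S] by auto
  have "(\<lambda>x. max (- \<bar>B\<bar>) (min \<bar>B\<bar> (f x))) \<in> bcontfun"
  proof (rule bcontfun_normI)
    show "continuous_on UNIV (\<lambda>x. max (- \<bar>B\<bar>) (min \<bar>B\<bar> (f x)))"
      by (intro continuous_intros f)
    show "norm (max (- \<bar>B\<bar>) (min \<bar>B\<bar> (f x))) \<le> \<bar>B\<bar>" for x by auto
  qed
  moreover have "f x = max (- \<bar>B\<bar>) (min \<bar>B\<bar> (f x))" if "x \<in> S" for x
    using B[OF that] by auto
  ultimately show ?thesis
    by (intro exI[of _ "Bcontfun (\<lambda>x. max (- \<bar>B\<bar>) (min \<bar>B\<bar> (f x)))"]) (simp add: Bcontfun_inverse)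
qed

theorem theorem2p3:
  fixes \<Omega> :: "'a::euclidean_space set"
    and \<Omega>\<^sub>\<epsilon> :: "real \<Rightarrow> 'a set"
    and X J u\<^sub>0 h\<^sub>0 :: "'a \<Rightarrow> real"
    and g :: "real \<Rightarrow> real"
    and u :: "real \<Rightarrow> real \<Rightarrow> 'a \<Rightarrow> real"
  assumes "open \<Omega>" and "connected \<Omega>" and "\<Omega> \<noteq> {}" and "bounded \<Omega>"
    and "\<And>\<epsilon>. \<epsilon> > 0 \<Longrightarrow> open (\<Omega>\<^sub>\<epsilon> \<epsilon>) \<and> \<Omega>\<^sub>\<epsilon> \<epsilon> \<subseteq> \<Omega>"
    and "X \<in> borel_measurable lebesgue" and "\<exists>C. AE x in lebesgue. \<bar>X x\<bar> \<le> C"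
    and "\<And>x. x \<notin> \<Omega> \<Longrightarrow> X x = 0"
    and "\<And>\<phi>. integrable (lebesgue_on \<Omega>) \<phi> \<Longrightarrow>
          ((\<lambda>\<epsilon>. LINT x|lebesgue_on \<Omega>. indicator (\<Omega>\<^sub>\<epsilon> \<epsilon>) x * \<phi> x) \<longlongrightarrow>
           (LINT x|lebesgue_on \<Omega>. X x * \<phi> x)) (at_right 0)"
    and "\<exists>c>0. \<forall>x\<in>\<Omega>. c \<le> X x" and "\<And>x. X x \<le> 1"
    and "continuous_on UNIV J" and "\<And>x. 0 \<le> J x" and "0 < J 0" and "\<And>x. J (- x) = J x"
    and "has_bochner_integral lebesgue J 1"
    and "\<exists>L. L-lipschitz_on UNIV g"
    and "C1 J" and "C1_closure \<Omega> X" and "C1_closure \<Omega> u\<^sub>0" and "C2 g"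
    and "h\<^sub>0 = (\<lambda>x. 1) \<or> h\<^sub>0 = neumann_coeff \<Omega> J X"
    and "\<And>\<delta>. \<delta> > 0 \<Longrightarrow> nonlocal_solution \<Omega> J X h\<^sub>0 g (local_mean X \<delta>) u\<^sub>0 (u \<delta>)"
  shows "\<exists>ubar :: real \<Rightarrow> 'a \<Rightarrow> real.
      (\<forall>t x. x \<notin> \<Omega> \<longrightarrow> ubar t x = 0) \<and>
      (\<forall>a b. a < b \<longrightarrow> C1_L2 UNIV {a..b} ubar) \<and>
      (\<forall>a b. a < b \<longrightarrow> Linf_L2_weakstar_tendsto \<Omega> {a..b} u ubar (at_right 0)) \<and>
      nonlocal_solution \<Omega> J X h\<^sub>0 g (\<lambda>x w. 1 / X x * w x) u\<^sub>0 ubar"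
proof -
  have open_\<Omega>: "open \<Omega>" and bounded_\<Omega>: "bounded \<Omega>" and Xm: "X \<in> borel_measurable lebesgue"
    and X0: "\<And>x. x \<notin> \<Omega> \<Longrightarrow> X x = 0" and X1: "\<And>x. X x \<le> 1" and J: "continuous_on UNIV J"
    and Jint: "has_bochner_integral lebesgue J 1"
    and sol: "\<And>\<delta>. \<delta> > 0 \<Longrightarrow> nonlocal_solution \<Omega> J X h\<^sub>0 g (local_mean X \<delta>) u\<^sub>0 (u \<delta>)"
    by fact+
  obtain c where c: "c > 0" "\<And>x. x \<in> \<Omega> \<Longrightarrow> c \<le> X x" using \<open>\<exists>c>0. \<forall>x\<in>\<Omega>. c \<le> X x\<close> by blast
  interpret positive_density \<Omega> X c
    by standard (fact open_\<Omega> bounded_\<Omega> Xm X0 X1 c)+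
  obtain L where L: "L-lipschitz_on UNIV g" using \<open>\<exists>L. L-lipschitz_on UNIV g\<close> by blast
  have g: "\<bar>g s - g t\<bar> \<le> L * \<bar>s - t\<bar>" for s t
    using lipschitz_onD[OF L, of s t] by (simp add: dist_real_def)
  have L0: "0 \<le> L" by (rule lipschitz_on_nonneg[OF L])
  have ext: "\<exists>z :: 'a \<Rightarrow>\<^sub>C real. \<forall>x\<in>\<Omega>. f x = apply_bcontfun z x" if f: "C1_closure \<Omega> f" for f
  proof -
    obtain F where F: "C1 F" "\<forall>x\<in>\<Omega>. f x = F x" using f unfolding C1_closure_def by blast
    obtain z :: "'a \<Rightarrow>\<^sub>C real" where "\<forall>x\<in>\<Omega>. F x = apply_bcontfun z x"
      using ex_bcontfun_eq_on_bounded[OF C1_imp_continuous[OF F(1)] bounded_\<Omega>] by blast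
    with F(2) show ?thesis by auto
  qed
  obtain ub :: "'a \<Rightarrow>\<^sub>C real" where ub: "\<And>x. x \<in> \<Omega> \<Longrightarrow> u\<^sub>0 x = apply_bcontfun ub x"
    using ext[OF \<open>C1_closure \<Omega> u\<^sub>0\<close>] by blast
  obtain Xb :: "'a \<Rightarrow>\<^sub>C real" where Xb: "\<And>x. c \<le> apply_bcontfun Xb x"
    "\<And>x. x \<in> \<Omega> \<Longrightarrow> X x = apply_bcontfun Xb x"
  proof -
    obtain z :: "'a \<Rightarrow>\<^sub>C real" where z: "\<And>x. x \<in> \<Omega> \<Longrightarrow> X x = apply_bcontfun z x"
      using ext[OF \<open>C1_closure \<Omega> X\<close>] by blast
    have "(\<lambda>x. max c (apply_bcontfun z x)) \<in> bcontfun"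
    proof (rule bcontfun_normI)
      show "norm (max c (apply_bcontfun z x)) \<le> c + norm z" for x
        using norm_bounded[of z x] c(1) by auto
    qed (intro continuous_on_max continuous_on_const continuous_on_apply_bcontfun)
    then have "apply_bcontfun (Bcontfun (\<lambda>x. max c (apply_bcontfun z x))) = (\<lambda>x. max c (apply_bcontfun z x))"
      by (simp add: Bcontfun_inverse)
    then show ?thesis
      using that[of "Bcontfun (\<lambda>x. max c (apply_bcontfun z x))"] z c(2) by (auto simp: max_def)
  qed
  obtain Jb :: "'a \<Rightarrow>\<^sub>C real" where Jb: "\<And>x y. x \<in> \<Omega> \<Longrightarrow> y \<in> \<Omega> \<Longrightarrow> J (x - y) = apply_bcontfun Jb (x - y)"
  proof -
    have "bounded ((\<lambda>p. fst p - snd p) ` (\<Omega> \<times> \<Omega>))"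
      by (intro bounded_minus_comp bounded_subset[OF bounded_\<Omega>]) auto
    then obtain z :: "'a \<Rightarrow>\<^sub>C real"
      where z: "\<forall>d\<in>(\<lambda>p. fst p - snd p) ` (\<Omega> \<times> \<Omega>). J d = apply_bcontfun z d"
      using ex_bcontfun_eq_on_bounded[OF J] by blast
    have "J (x - y) = apply_bcontfun z (x - y)" if "x \<in> \<Omega>" "y \<in> \<Omega>" for x y
      using z that by force
    then show ?thesis by (rule that)
  qed
  obtain hb :: "'a \<Rightarrow>\<^sub>C real" where hb: "\<And>x. x \<in> \<Omega> \<Longrightarrow> h\<^sub>0 x = apply_bcontfun hb x"
  proof -
    from \<open>h\<^sub>0 = (\<lambda>x. 1) \<or> h\<^sub>0 = neumann_coeff \<Omega> J X\<close> show ?thesis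
    proof
      assume "h\<^sub>0 = (\<lambda>x. 1)"
      then show ?thesis using that[of "const_bcontfun 1"] by simp
    next
      assume h: "h\<^sub>0 = neumann_coeff \<Omega> J X"
      define q where "q y = indicator \<Omega> y - X y" for y
      have q: "integrable lebesgue q"
        unfolding q_def[abs_def] using X_integrable \<Omega>_lmeasurable
        by (intro Bochner_Integration.integrable_diff integrable_real_indicator) (auto simp: fmeasurable_def)
      note conv = convolution_bounded_continuous[of "apply_bcontfun Jb" "norm Jb" q,
          OF continuous_on_apply_bcontfun _ q]
      have Jbb: "\<bar>apply_bcontfun Jb x\<bar> \<le> norm Jb" for x using norm_bounded[of Jb x] by simp
      \<comment> \<open>The integral of \<open>J\<close> over the whole space is \<open>1\<close>, and the rest of the integrand lives on \<open>\<Omega>\<close>,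
        where \<open>J\<close> may be replaced by \<open>Jb\<close>.\<close>
      define H where "H x = 1 - (LINT y|lebesgue. apply_bcontfun Jb (x - y) * q y)" for x
      have "H \<in> bcontfun"
      proof (rule bcontfun_normI)
        show "continuous_on UNIV H"
          unfolding H_def[abs_def] by (intro continuous_on_diff continuous_on_const conv(2) Jbb)
        show "norm (H x) \<le> 1 + norm Jb * (LINT y|lebesgue. \<bar>q y\<bar>)" for x
          using conv(3)[OF Jbb, of x] unfolding H_def by simp
      qed
      then have H: "apply_bcontfun (Bcontfun H) = H" by (simp add: Bcontfun_inverse)
      have "h\<^sub>0 x = H x" if x: "x \<in> \<Omega>" for x
      proof -
        have Jx: "integrable lebesgue (\<lambda>y. J (x - y))" "(LINT y|lebesgue. J (x - y)) = 1"
          using has_bochner_integral_reflect_translate[OF J Jint, of x]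
          by (auto simp: has_bochner_integral_iff)
        have eq: "J (x - y) * (1 - indicator \<Omega> y + X y) = J (x - y) - apply_bcontfun Jb (x - y) * q y" for y
          using Jb[OF x, of y] X0[of y] by (cases "y \<in> \<Omega>") (auto simp: q_def algebra_simps)
        show ?thesis
          unfolding h neumann_coeff_def eq H_def using Jx conv(1)[OF Jbb, of x] by simp
      qed
      then show ?thesis using that[of "Bcontfun H"] by (simp add: H)
    qed
  qed
  interpret nonlocal_problem \<Omega> X c J h\<^sub>0 u\<^sub>0 Jb hb ub Xb g L
    by standard (fact Jb hb ub Xb g L0)+
  show ?thesis by (rule solutions_converge_to_limit[OF sol])
qed

end
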